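(* Let $\{X_n,n\ge1\}$ be a martingale difference sequence with respect to an increasing sequence of $\sigma$-fields $\{\mathcal{F}_n,n\ge0\}$, and let $S_n=X_1+\cdots+X_n$ and $V_n=(X_1^2+\cdots+X_n^2)^{1/2}$. Suppose that $|X_n|\le m_n$ a.s. for some $\mathcal{F}_{n-1}$-measurable random variable $m_n$ $(n\ge1)$, with $V_n\to\infty$ a.s. and $m_n/\{V_n(\log\log V_n)^{-1/2}\}\to0$ a.s. Then, almost surely, the cluster set of the sequence $$\big\{S_n/[V_n(\log\log(V_n\vee e^2))^{1/2}]\big\}$$ is the interval $[-\sqrt2,\sqrt2]$.
   Context: The cluster set of a real sequence is the set of all its limit points (limits of subsequences). $a\vee b=\max(a,b)$. Expressions involving $\log\log V_n$ (and division by $V_n$) are considered for all large $n$ only. *)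

theory Defs
  imports "HOL-Probability.Probability"
begin

text \<open>The differences are indexed by \<open>n \<ge> 1\<close> and the \<open>\<sigma>\<close>-fields by \<open>n \<ge> 0\<close>;
  \<open>X 0\<close> is unconstrained and is never used.\<close>

definition martingale_difference_sequence ::
    "'a measure \<Rightarrow> (nat \<Rightarrow> 'a measure) \<Rightarrow> (nat \<Rightarrow> 'a \<Rightarrow> real) \<Rightarrow> bool" where
  "martingale_difference_sequence M F X \<longleftrightarrow>
     filtration (space M) F \<and>
     (\<forall>n. subalgebra M (F n)) \<and>
     (\<forall>n\<ge>1. X n \<in> borel_measurable (F n) \<and> integrable M (X n) \<and>
            (AE \<omega> in M. real_cond_exp M (F (n - 1)) (X n) \<omega> = 0))"

definition partial_sum :: "(nat \<Rightarrow> 'a \<Rightarrow> real) \<Rightarrow> nat \<Rightarrow> 'a \<Rightarrow> real" where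
  "partial_sum X n \<omega> = (\<Sum>i=1..n. X i \<omega>)"

definition root_square_sum :: "(nat \<Rightarrow> 'a \<Rightarrow> real) \<Rightarrow> nat \<Rightarrow> 'a \<Rightarrow> real" where
  "root_square_sum X n \<omega> = sqrt (\<Sum>i=1..n. (X i \<omega>)\<^sup>2)"

definition cluster_set :: "(nat \<Rightarrow> real) \<Rightarrow> real set" where
  "cluster_set s = {x. \<exists>r :: nat \<Rightarrow> nat. strict_mono r \<and> (s \<circ> r) \<longlonglongrightarrow> x}"

end

theory Submission
  imports Defs "HOL-Real_Asymp.Real_Asymp"
begin

text \<open>
  The martingale property enters only through one consequence: a bet on the next difference, with a
  bounded stake that is decided before that difference is seen, has expectation \<open>0\<close>. A process that
  never grows by more than the proceeds of such a bet therefore has nonincreasing expectation, and every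
  probabilistic estimate reduces to a pointwise inequality that says how to bet
  (\<open>hedged_integral_le\<close>, \<open>hedged_maximal\<close>).

  \<^emph>\<open>Upper bound.\<close> For small \<open>y\<close> one has \<open>exp (y - (1 + e) y\<^sup>2 / 2) \<le> 1 + y\<close>, so
  \<open>exp (l S - (1 + e) l\<^sup>2 V\<^sup>2 / 2)\<close> is hedged as long as the differences are at most a small multiple of
  \<open>1 / l\<close>. Here the random quantity \<open>V\<^sup>2\<close> itself is the clock. On the block \<open>r\<^sup>k \<le> V\<^sup>2 \<le> r\<^sup>k\<^sup>+\<^sup>1\<close> the
  choice \<open>l\<^sup>2 = 2 ln k / r\<^sup>k\<close> is admissible by the growth assumption on \<open>m\<close>, and the maximal inequality
  bounds the probability of \<open>S > (1 + h) sqrt (2 V\<^sup>2 ln k)\<close> somewhere in the block by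
  \<open>k powr - (1 + h)\<close>. Borel--Cantelli and \<open>ln (ln V) \<sim> ln k\<close> finish this half.

  \<^emph>\<open>Lower bound.\<close> The reversed inequality \<open>1 + y \<le> exp (y - (1 - e) y\<^sup>2 / 2)\<close> makes the exponential
  with \<open>1 - e\<close> grow at least like a bet. Subtracting two exponentials with slightly smaller and
  slightly larger \<open>l\<close> gives a function of \<open>S\<close> and \<open>V\<^sup>2\<close> (\<open>tilt\<close>) that starts at \<open>1 / 2\<close>, is bounded by
  a constant times \<open>k\<close>, and is at most \<open>0\<close> at the end of the block unless \<open>S\<close> has grown in the block by
  nearly \<open>sqrt (2 r\<^sup>k\<^sup>+\<^sup>1 ln k)\<close>. Betting against this growth multiplies the capital by at least
  \<open>1 + const / k\<close> in every block in which \<open>S\<close> does not grow that much. Different blocks use different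
  differences, so the capitals multiply; as \<open>\<Sum> 1 / k\<close> diverges, almost surely \<open>S\<close> grows
  that much in infinitely many blocks (\<open>hit_AE\<close>). This plays the part of the conditional
  Borel--Cantelli lemma. For large \<open>r\<close> the value of \<open>S\<close> at the start of the block is negligible, by
  the upper bound for \<open>- S\<close>.

  \<^emph>\<open>Cluster set.\<close> Applied to \<open>X\<close> and \<open>- X\<close>, the two halves give upper and lower limit \<open>\<plusminus> sqrt 2\<close>.
  The increments of the normalized sums tend to \<open>0\<close>, so the sequence comes close to every value
  in between infinitely often (\<open>cluster_set_eq_interval\<close>).
\<close>

section \<open>Elementary inequalities\<close>

text \<open>Comparing logarithms, the difference of the two sides vanishes at \<open>0\<close> and has derivative
  \<open>y (1 + e - 1 / (1 + y))\<close>, which has the sign of \<open>y\<close> for \<open>\<bar>y\<bar> \<le> e / 2\<close>. The slack \<open>e\<close> absorbs the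
  cubic term of the logarithm.\<close>

lemma exp_le_one_plus:
  fixes e y :: real
  assumes "0 < e" "e \<le> 1" "\<bar>y\<bar> \<le> e / 2"
  shows "exp (y - (1 + e) * y\<^sup>2 / 2) \<le> 1 + y"
proof -
  define h where "h z = ln (1 + z) - z + (1 + e) * z\<^sup>2 / 2" for z :: real
  have der: "(h has_real_derivative z * (1 + e - 1 / (1 + z))) (at z)" if "\<bar>z\<bar> \<le> e / 2" for z
    unfolding h_def using that assms
    by (auto intro!: derivative_eq_intros simp: field_simps power2_eq_square)
  have pos: "1 + e - 1 / (1 + z) \<ge> 0" if "\<bar>z\<bar> \<le> e / 2" for z
  proof -
    have "1 + z \<ge> 1 - e / 2" "1 - e / 2 > 0" using that assms by auto
    moreover have "(1 + e) * (1 - e / 2) \<ge> 1"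
      using mult_left_le[of e e] assms by (simp add: algebra_simps)
    moreover have "(1 + e) * (1 + z) \<ge> (1 + e) * (1 - e / 2)"
      using calculation(1) assms by (intro mult_left_mono) auto
    ultimately show ?thesis by (simp add: field_simps)
  qed
  have h0: "h 0 = 0" by (simp add: h_def)
  have "h y \<ge> 0"
  proof (cases "y \<ge> 0")
    case True
    have "h 0 \<le> h y"
      by (rule DERIV_nonneg_imp_nondecreasing[OF True])
        (metis True abs_le_iff abs_of_nonneg assms(3) der dual_order.trans mult_nonneg_nonneg pos)
    thus ?thesis using h0 by simp
  next
    case False
    have "h y \<ge> h 0"
    proof (rule DERIV_nonpos_imp_nonincreasing[of y 0 h])
      show "y \<le> 0" using False by simp
      fix z assume "y \<le> z" "z \<le> 0"
      hence "\<bar>z\<bar> \<le> e / 2" using assms by auto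
      thus "\<exists>D. (h has_real_derivative D) (at z) \<and> D \<le> 0"
        using der pos \<open>z \<le> 0\<close> by (meson mult_nonpos_nonneg)
    qed
    thus ?thesis using h0 by simp
  qed
  moreover have "1 + y > 0" using assms by auto
  ultimately show ?thesis
    unfolding h_def by (subst ln_ge_iff[symmetric]) auto
qed

lemma one_plus_le_exp:
  fixes e y :: real
  assumes "0 < e" "e \<le> 1" "\<bar>y\<bar> \<le> e / 2"
  shows "1 + y \<le> exp (y - (1 - e) * y\<^sup>2 / 2)"
proof -
  define h where "h z = z - (1 - e) * z\<^sup>2 / 2 - ln (1 + z)" for z :: real
  have der: "(h has_real_derivative z * (1 / (1 + z) - (1 - e))) (at z)" if "\<bar>z\<bar> \<le> e / 2" for z
    unfolding h_def using that assms
    by (auto intro!: derivative_eq_intros simp: field_simps power2_eq_square)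
  have pos: "1 / (1 + z) - (1 - e) \<ge> 0" if "\<bar>z\<bar> \<le> e / 2" for z
  proof -
    have "1 + z \<le> 1 + e / 2" "1 + z > 0" using that assms by auto
    moreover have "(1 - e) * (1 + e / 2) \<le> 1"
      using assms by (simp add: algebra_simps)
    moreover have "(1 - e) * (1 + z) \<le> (1 - e) * (1 + e / 2)"
      using calculation(1) assms by (intro mult_left_mono) auto
    ultimately show ?thesis by (simp add: field_simps)
  qed
  have h0: "h 0 = 0" by (simp add: h_def)
  have "h y \<ge> 0"
  proof (cases "y \<ge> 0")
    case True
    have "h 0 \<le> h y"
      by (rule DERIV_nonneg_imp_nondecreasing[OF True])
        (metis True abs_le_iff abs_of_nonneg assms(3) der dual_order.trans mult_nonneg_nonneg pos)
    thus ?thesis using h0 by simp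
  next
    case False
    have "h y \<ge> h 0"
    proof (rule DERIV_nonpos_imp_nonincreasing[of y 0 h])
      show "y \<le> 0" using False by simp
      fix z assume "y \<le> z" "z \<le> 0"
      hence "\<bar>z\<bar> \<le> e / 2" using assms by auto
      thus "\<exists>D. (h has_real_derivative D) (at z) \<and> D \<le> 0"
        using der pos \<open>z \<le> 0\<close> by (meson mult_nonpos_nonneg)
    qed
    thus ?thesis using h0 by simp
  qed
  moreover have "1 + y > 0" using assms by auto
  ultimately show ?thesis
    unfolding h_def by (subst ln_le_cancel_iff[symmetric]) auto
qed

text \<open>The function \<open>x / ln (ln x)\<close> increases from \<open>exp (exp 1)\<close> on. Cross-multiplied, this lets a
  bound on \<open>b\<^sup>2 ln (ln V) / V\<^sup>2\<close> at one time be transported to the end of the block.\<close>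

lemma ln_ln_over_antimono:
  fixes x y :: real
  assumes "exp (exp 1) \<le> x" "x \<le> y"
  shows "x * ln (ln y) \<le> y * ln (ln x)"
proof -
  have x0: "x > 0" using assms(1) by (meson exp_gt_zero less_le_trans)
  have lx: "ln x \<ge> exp 1" using assms(1) x0 by (simp add: ln_ge_iff)
  have lx1: "ln x \<ge> 1" using lx exp_ge_add_one_self[of 1] by simp
  have x1: "x > 1" using lx1 x0 ln_le_zero_iff[of x] by linarith
  have llx: "ln (ln x) \<ge> 1" using lx lx1 by (simp add: ln_ge_iff)
  have ly: "ln y > 0" using lx1 assms x0 by (smt (verit) ln_mono)
  have "ln (ln y) - ln (ln x) = ln (ln y / ln x)" using lx1 ly by (simp add: ln_div)
  also have "\<dots> \<le> ln y / ln x - 1" using lx1 ly by (intro ln_le_minus_one) auto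
  also have "\<dots> = ln (y / x) / ln x" using lx1 x0 x1 assms by (simp add: ln_div diff_divide_distrib)
  also have "\<dots> \<le> (y / x - 1) / ln x"
    using lx1 x0 x1 assms by (intro divide_right_mono ln_le_minus_one) auto
  also have "\<dots> \<le> (y / x - 1) * 1"
    using lx1 x0 x1 assms mult_right_mono[of 1 "ln x" "y / x - 1"] by (simp add: divide_le_eq mult.commute)
  also have "\<dots> \<le> (y / x - 1) * ln (ln x)"
    using llx x0 assms by (intro mult_left_mono) auto
  finally have "ln (ln y) \<le> (y / x) * ln (ln x)" by (simp add: algebra_simps)
  thus ?thesis using x0 by (simp add: field_simps)
qed

section \<open>Bets against a fair game\<close>

text \<open>Time is shifted by one with respect to the theorem: \<open>x n\<close> stands for the difference \<open>X (n + 1)\<close>,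
  revealed after the information in \<open>F n\<close>, and \<open>b n\<close> for its predictable bound \<open>m (n + 1)\<close>. The
  martingale property is stated as fairness of all bounded bets, and the bound holds everywhere
  instead of almost everywhere, so that the pointwise comparisons below have no exceptional sets.\<close>

locale bounded_fair_game = prob_space M
  for M :: "'a measure" +
  fixes F :: "nat \<Rightarrow> 'a measure" and x b :: "nat \<Rightarrow> 'a \<Rightarrow> real"
  assumes sub: "\<And>n. subalgebra M (F n)"
    and filt: "\<And>n. sets (F n) \<subseteq> sets (F (Suc n))"
    and x_measurable: "\<And>n. x n \<in> borel_measurable (F (Suc n))"
    and b_measurable: "\<And>n. b n \<in> borel_measurable (F n)"
    and x_bound: "\<And>n \<omega>. \<omega> \<in> space M \<Longrightarrow> \<bar>x n \<omega>\<bar> \<le> b n \<omega>"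
    and x_integrable: "\<And>n. integrable M (x n)"
    and fair: "\<And>n g B. g \<in> borel_measurable (F n) \<Longrightarrow> (\<And>\<omega>. \<omega> \<in> space M \<Longrightarrow> \<bar>g \<omega>\<bar> \<le> B)
        \<Longrightarrow> (\<integral>\<omega>. g \<omega> * x n \<omega> \<partial>M) = 0"
begin

lemma space_F [simp]: "space (F n) = space M"
  using sub by (simp add: subalgebra_def)

lemma measurable_F_M: "f \<in> borel_measurable (F n) \<Longrightarrow> f \<in> borel_measurable M"
  using measurable_from_subalg[OF sub] .

lemma measurable_F_Suc: "f \<in> borel_measurable (F n) \<Longrightarrow> f \<in> borel_measurable (F (Suc n))"
  by (rule measurable_from_subalg[of "F (Suc n)" "F n"]) (auto simp: subalgebra_def filt)

text \<open>The admissible stakes at time \<open>n\<close>.\<close>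

definition bounded_meas :: "nat \<Rightarrow> ('a \<Rightarrow> real) set" where
  "bounded_meas n = {f \<in> borel_measurable (F n). \<exists>B. \<forall>\<omega>\<in>space M. \<bar>f \<omega>\<bar> \<le> B}"

lemma bounded_meas_measurable: "f \<in> bounded_meas n \<Longrightarrow> f \<in> borel_measurable (F n)"
  by (simp add: bounded_meas_def)

lemma bounded_meas_Suc: "f \<in> bounded_meas n \<Longrightarrow> f \<in> bounded_meas (Suc n)"
  using measurable_F_Suc by (auto simp: bounded_meas_def)

lemma bounded_meas_const [intro]: "(\<lambda>\<omega>. c) \<in> bounded_meas n"
  by (auto simp: bounded_meas_def)

lemma bounded_meas_add [intro]:
  assumes "f \<in> bounded_meas n" "g \<in> bounded_meas n" shows "(\<lambda>\<omega>. f \<omega> + g \<omega>) \<in> bounded_meas n"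
proof -
  from assms obtain B B' where "\<forall>\<omega>\<in>space M. \<bar>f \<omega>\<bar> \<le> B" "\<forall>\<omega>\<in>space M. \<bar>g \<omega>\<bar> \<le> B'"
    by (auto simp: bounded_meas_def)
  hence "\<forall>\<omega>\<in>space M. \<bar>f \<omega> + g \<omega>\<bar> \<le> B + B'"
    by (meson abs_triangle_ineq add_mono order_trans)
  thus ?thesis using assms by (auto simp: bounded_meas_def)
qed

lemma bounded_meas_mult [intro]:
  assumes "f \<in> bounded_meas n" "g \<in> bounded_meas n" shows "(\<lambda>\<omega>. f \<omega> * g \<omega>) \<in> bounded_meas n"
proof -
  from assms obtain B B' where B: "\<forall>\<omega>\<in>space M. \<bar>f \<omega>\<bar> \<le> B" "\<forall>\<omega>\<in>space M. \<bar>g \<omega>\<bar> \<le> B'"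
    by (auto simp: bounded_meas_def)
  hence "\<forall>\<omega>\<in>space M. \<bar>f \<omega> * g \<omega>\<bar> \<le> \<bar>B\<bar> * \<bar>B'\<bar>"
    unfolding abs_mult by (intro ballI mult_mono) (auto intro: order_trans)
  thus ?thesis using assms by (auto simp: bounded_meas_def)
qed

lemma bounded_meas_diff [intro]:
  assumes "f \<in> bounded_meas n" "g \<in> bounded_meas n" shows "(\<lambda>\<omega>. f \<omega> - g \<omega>) \<in> bounded_meas n"
  using bounded_meas_add[OF assms(1) bounded_meas_mult[OF bounded_meas_const[of "-1"] assms(2)]] by simp

lemma bounded_meas_cmult [intro]: "f \<in> bounded_meas n \<Longrightarrow> (\<lambda>\<omega>. c * f \<omega>) \<in> bounded_meas n"
  by (rule bounded_meas_mult) auto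

lemma bounded_meas_divide [intro]: "f \<in> bounded_meas n \<Longrightarrow> (\<lambda>\<omega>. f \<omega> / c) \<in> bounded_meas n"
  using bounded_meas_cmult[of f n "1 / c"] by simp

lemma bounded_meas_exp [intro]:
  assumes "f \<in> bounded_meas n" shows "(\<lambda>\<omega>. exp (f \<omega>)) \<in> bounded_meas n"
proof -
  from assms obtain B where B: "\<forall>\<omega>\<in>space M. \<bar>f \<omega>\<bar> \<le> B"
    by (auto simp: bounded_meas_def)
  hence "\<forall>\<omega>\<in>space M. \<bar>exp (f \<omega>)\<bar> \<le> exp B" by auto
  thus ?thesis using assms by (auto simp: bounded_meas_def)
qed

lemma bounded_meas_if [intro]:
  assumes "f \<in> bounded_meas n" "g \<in> bounded_meas n" "Measurable.pred (F n) P"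
  shows "(\<lambda>\<omega>. if P \<omega> then f \<omega> else g \<omega>) \<in> bounded_meas n"
proof -
  from assms obtain B B' where B: "\<forall>\<omega>\<in>space M. \<bar>f \<omega>\<bar> \<le> B" "\<forall>\<omega>\<in>space M. \<bar>g \<omega>\<bar> \<le> B'"
    by (auto simp: bounded_meas_def)
  have "\<bar>if P \<omega> then f \<omega> else g \<omega>\<bar> \<le> max B B'" if "\<omega> \<in> space M" for \<omega>
    using B that by (auto intro: order_trans simp: le_max_iff_disj)
  moreover have "(\<lambda>\<omega>. if P \<omega> then f \<omega> else g \<omega>) \<in> borel_measurable (F n)"
    using assms by (intro measurable_If) (auto simp: bounded_meas_def pred_def)
  ultimately show ?thesis unfolding bounded_meas_def by blast
qed

lemma bounded_meas_sum [intro]: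
  "(\<And>i. i \<in> A \<Longrightarrow> f i \<in> bounded_meas n) \<Longrightarrow> (\<lambda>\<omega>. \<Sum>i\<in>A. f i \<omega>) \<in> bounded_meas n"
  by (induction A rule: infinite_finite_induct) (auto intro!: bounded_meas_add)

lemma bounded_meas_prod [intro]:
  "(\<And>i. i \<in> A \<Longrightarrow> f i \<in> bounded_meas n) \<Longrightarrow> (\<lambda>\<omega>. \<Prod>i\<in>A. f i \<omega>) \<in> bounded_meas n"
  by (induction A rule: infinite_finite_induct) (auto intro!: bounded_meas_mult)

lemma bounded_meas_integrable:
  assumes "f \<in> bounded_meas n" shows "integrable M f"
proof -
  from assms obtain B where "\<forall>\<omega>\<in>space M. \<bar>f \<omega>\<bar> \<le> B"
    by (auto simp: bounded_meas_def)
  thus ?thesis using assms measurable_F_M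
    by (intro integrable_const_bound[of _ B]) (auto simp: bounded_meas_def)
qed

text \<open>A hedged process is a supermartingale in a strong pointwise sense: the stake \<open>g\<close> that
  dominates its next increment is given explicitly. This replaces conditional expectations.\<close>

definition hedged :: "(nat \<Rightarrow> 'a \<Rightarrow> real) \<Rightarrow> bool" where
  "hedged W \<longleftrightarrow> (\<forall>n. W n \<in> bounded_meas n \<and>
     (\<exists>g\<in>bounded_meas n. \<forall>\<omega>\<in>space M. W (Suc n) \<omega> \<le> W n \<omega> + g \<omega> * x n \<omega>))"

lemma hedged_integral_le:
  assumes "hedged W"
  shows "(\<integral>\<omega>. W n \<omega> \<partial>M) \<le> (\<integral>\<omega>. W 0 \<omega> \<partial>M)"
proof (induction n)
  case (Suc n)
  from assms obtain g where g: "g \<in> bounded_meas n" "\<forall>\<omega>\<in>space M. W (Suc n) \<omega> \<le> W n \<omega> + g \<omega> * x n \<omega>"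
    unfolding hedged_def by blast
  have W: "integrable M (W n)" "integrable M (W (Suc n))"
    using assms bounded_meas_integrable unfolding hedged_def by blast+
  obtain B where B: "\<forall>\<omega>\<in>space M. \<bar>g \<omega>\<bar> \<le> B" using g(1) by (auto simp: bounded_meas_def)
  have gx: "integrable M (\<lambda>\<omega>. g \<omega> * x n \<omega>)"
  proof (rule Bochner_Integration.integrable_bound[of M "\<lambda>\<omega>. B * x n \<omega>"])
    show "integrable M (\<lambda>\<omega>. B * x n \<omega>)" using x_integrable by simp
    show "(\<lambda>\<omega>. g \<omega> * x n \<omega>) \<in> borel_measurable M"
      using measurable_F_M[OF bounded_meas_measurable[OF g(1)]] measurable_F_M[OF x_measurable] by simp
    show "AE \<omega> in M. norm (g \<omega> * x n \<omega>) \<le> norm (B * x n \<omega>)"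
      using B by (intro AE_I2) (auto simp: abs_mult intro!: mult_right_mono intro: order_trans)
  qed
  have "(\<integral>\<omega>. W (Suc n) \<omega> \<partial>M) \<le> (\<integral>\<omega>. W n \<omega> + g \<omega> * x n \<omega> \<partial>M)"
    using g(2) W gx by (intro integral_mono) auto
  also have "\<dots> = (\<integral>\<omega>. W n \<omega> \<partial>M)"
    using W gx fair[OF bounded_meas_measurable[OF g(1)], of B] B by simp
  finally show ?case using Suc by simp
qed simp

lemma hedged_prob_le:
  assumes "hedged W" "\<And>\<omega>. \<omega> \<in> space M \<Longrightarrow> W 0 \<omega> = 1" "\<And>n \<omega>. \<omega> \<in> space M \<Longrightarrow> W n \<omega> \<ge> 0" "K > 0"
  shows "prob {\<omega>\<in>space M. W n \<omega> \<ge> K} \<le> 1 / K"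
proof -
  have W: "integrable M (W n)"
    using assms bounded_meas_integrable unfolding hedged_def by blast
  have "prob {\<omega>\<in>space M. W n \<omega> \<ge> K} \<le> (\<integral>\<omega>. W n \<omega> \<partial>M) / K"
    using integral_Markov_inequality_measure[OF W, of "{}" K] assms by simp
  also have "(\<integral>\<omega>. W n \<omega> \<partial>M) \<le> (\<integral>\<omega>. W 0 \<omega> \<partial>M)" by (rule hedged_integral_le) fact
  also have "(\<integral>\<omega>. W 0 \<omega> \<partial>M) = (\<integral>\<omega>. 1 \<partial>M)" using assms by (intro Bochner_Integration.integral_cong) auto
  also have "\<dots> = 1" by (simp add: prob_space)
  finally show ?thesis using assms by (simp add: divide_right_mono)
qed

text \<open>The process frozen when it first reaches \<open>K\<close>. Its stake is the old one as
  long as \<open>K\<close> has not been reached, which is known before the next difference.\<close>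

primrec stopped :: "(nat \<Rightarrow> 'a \<Rightarrow> real) \<Rightarrow> real \<Rightarrow> nat \<Rightarrow> 'a \<Rightarrow> real" where
  "stopped W K 0 \<omega> = W 0 \<omega>"
| "stopped W K (Suc n) \<omega> = (if stopped W K n \<omega> \<ge> K then stopped W K n \<omega> else W (Suc n) \<omega>)"

lemma stopped_below: "stopped W K n \<omega> < K \<Longrightarrow> stopped W K n \<omega> = W n \<omega>"
  by (cases n) (auto split: if_splits)

lemma stopped_ge: "i \<le> n \<Longrightarrow> W i \<omega> \<ge> K \<Longrightarrow> stopped W K n \<omega> \<ge> K"
proof (induction n)
  case (Suc n)
  thus ?case using stopped_below[of W K n \<omega>] by (cases "i = Suc n") auto
qed simp

lemma hedged_stopped:
  assumes "hedged W" shows "hedged (stopped W K)"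
proof -
  have bounded_meas: "stopped W K n \<in> bounded_meas n" for n
  proof (induction n)
    case 0
    thus ?case using assms by (simp add: hedged_def)
  next
    case (Suc n)
    have [measurable]: "stopped W K n \<in> borel_measurable (F (Suc n))"
      using Suc bounded_meas_Suc bounded_meas_measurable by blast
    have "W (Suc n) \<in> bounded_meas (Suc n)" using assms by (simp add: hedged_def)
    thus ?case using bounded_meas_if[OF bounded_meas_Suc[OF Suc], of "W (Suc n)" "\<lambda>\<omega>. K \<le> stopped W K n \<omega>"] by simp
  qed
  show ?thesis unfolding hedged_def
  proof (intro allI conjI bounded_meas)
    fix n
    from assms obtain g where g: "g \<in> bounded_meas n" "\<forall>\<omega>\<in>space M. W (Suc n) \<omega> \<le> W n \<omega> + g \<omega> * x n \<omega>"
      unfolding hedged_def by blast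
    have [measurable]: "stopped W K n \<in> borel_measurable (F n)"
      using bounded_meas bounded_meas_measurable by blast
    show "\<exists>g\<in>bounded_meas n. \<forall>\<omega>\<in>space M. stopped W K (Suc n) \<omega> \<le> stopped W K n \<omega> + g \<omega> * x n \<omega>"
      using g stopped_below[of W K n]
      by (intro bexI[of _ "\<lambda>\<omega>. if stopped W K n \<omega> \<ge> K then 0 else g \<omega>"] bounded_meas_if) auto
  qed
qed

text \<open>Ville's maximal inequality: apply Markov's inequality to the stopped process and let the
  horizon tend to infinity.\<close>

lemma hedged_maximal:
  assumes "hedged W" "\<And>\<omega>. \<omega> \<in> space M \<Longrightarrow> W 0 \<omega> = 1" "\<And>n \<omega>. \<omega> \<in> space M \<Longrightarrow> W n \<omega> \<ge> 0" "K > 0"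
  shows "prob {\<omega>\<in>space M. \<exists>n. W n \<omega> \<ge> K} \<le> 1 / K"
proof -
  have [measurable]: "W n \<in> borel_measurable M" for n
    using assms bounded_meas_measurable measurable_F_M unfolding hedged_def by blast
  have st [measurable]: "stopped W K n \<in> borel_measurable M" for n
    using hedged_stopped[OF assms(1)] bounded_meas_measurable measurable_F_M unfolding hedged_def by blast
  define A where "A n = {\<omega>\<in>space M. \<exists>i\<le>n. W i \<omega> \<ge> K}" for n
  have A: "A n \<in> sets M" for n unfolding A_def by measurable
  have "(\<lambda>n. prob (A n)) \<longlonglongrightarrow> prob (\<Union>n. A n)"
    using A by (intro finite_Lim_measure_incseq) (auto simp: A_def incseq_def intro: order_trans)
  moreover have "prob (A n) \<le> 1 / K" for n
  proof -
    have nn: "stopped W K n \<omega> \<ge> 0" if "\<omega> \<in> space M" for n \<omega>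
      using assms(3)[OF that] by (induction n) auto
    have "prob (A n) \<le> prob {\<omega>\<in>space M. stopped W K n \<omega> \<ge> K}"
      using stopped_ge by (intro finite_measure_mono) (auto simp: A_def)
    also have "\<dots> \<le> 1 / K"
      by (rule hedged_prob_le) (use assms nn hedged_stopped in auto)
    finally show ?thesis .
  qed
  ultimately have "prob (\<Union>n. A n) \<le> 1 / K" by (intro LIMSEQ_le_const2) auto
  moreover have "(\<Union>n. A n) = {\<omega>\<in>space M. \<exists>n. W n \<omega> \<ge> K}" by (auto simp: A_def)
  ultimately show ?thesis by simp
qed

text \<open>Selecting the differences to bet on by a predictable \<open>J\<close> serves two purposes: it leaves out
  differences too large for the exponential inequalities, and it confines a bet to one block.\<close>

definition bet_sum :: "(nat \<Rightarrow> 'a \<Rightarrow> bool) \<Rightarrow> nat \<Rightarrow> 'a \<Rightarrow> real" where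
  "bet_sum J n \<omega> = (\<Sum>i<n. if J i \<omega> then x i \<omega> else 0)"

definition bet_square_sum :: "(nat \<Rightarrow> 'a \<Rightarrow> bool) \<Rightarrow> nat \<Rightarrow> 'a \<Rightarrow> real" where
  "bet_square_sum J n \<omega> = (\<Sum>i<n. if J i \<omega> then (x i \<omega>)\<^sup>2 else 0)"

definition bounded_bet :: "(nat \<Rightarrow> 'a \<Rightarrow> bool) \<Rightarrow> real \<Rightarrow> bool" where
  "bounded_bet J c \<longleftrightarrow> (\<forall>n. Measurable.pred (F n) (J n) \<and> (\<forall>\<omega>\<in>space M. J n \<omega> \<longrightarrow> b n \<omega> \<le> c))"

lemma bounded_meas_x:
  assumes "bounded_bet J c" shows "(\<lambda>\<omega>. if J n \<omega> then x n \<omega> else 0) \<in> bounded_meas (Suc n)"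
proof -
  have [measurable]: "Measurable.pred (F (Suc n)) (J n)"
    using assms filt[of n] by (auto simp: bounded_bet_def pred_def)
  have "(\<lambda>\<omega>. if J n \<omega> then x n \<omega> else 0) \<in> borel_measurable (F (Suc n))"
    using x_measurable[of n] by measurable
  moreover have "\<bar>if J n \<omega> then x n \<omega> else 0\<bar> \<le> \<bar>c\<bar>" if "\<omega> \<in> space M" for \<omega>
    using assms x_bound[OF that, of n] that by (fastforce simp: bounded_bet_def)
  ultimately show ?thesis unfolding bounded_meas_def by blast
qed

lemma bet_sum_bounded_meas:
  assumes "bounded_bet J c" shows "bet_sum J n \<in> bounded_meas n"
proof (induction n)
  case (Suc n)
  have "(\<lambda>\<omega>. bet_sum J n \<omega> + (if J n \<omega> then x n \<omega> else 0)) \<in> bounded_meas (Suc n)"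
    by (rule bounded_meas_add[OF bounded_meas_Suc[OF Suc] bounded_meas_x[OF assms]])
  thus ?case by (simp add: bet_sum_def[abs_def])
qed (auto simp: bet_sum_def[abs_def])

lemma bet_square_sum_bounded_meas:
  assumes "bounded_bet J c" shows "bet_square_sum J n \<in> bounded_meas n"
proof (induction n)
  case (Suc n)
  let ?y = "\<lambda>\<omega>. if J n \<omega> then x n \<omega> else 0"
  have "(\<lambda>\<omega>. bet_square_sum J n \<omega> + ?y \<omega> * ?y \<omega>) \<in> bounded_meas (Suc n)"
    by (rule bounded_meas_add[OF bounded_meas_Suc[OF Suc]
          bounded_meas_mult[OF bounded_meas_x[OF assms] bounded_meas_x[OF assms]]])
  also have "(\<lambda>\<omega>. bet_square_sum J n \<omega> + ?y \<omega> * ?y \<omega>) = bet_square_sum J (Suc n)"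
    by (auto simp: bet_square_sum_def fun_eq_iff power2_eq_square)
  finally show ?case .
qed (auto simp: bet_square_sum_def[abs_def])

lemma bet_sum_Suc: "bet_sum J (Suc n) \<omega> = bet_sum J n \<omega> + (if J n \<omega> then x n \<omega> else 0)"
  by (simp add: bet_sum_def)

lemma bet_square_sum_Suc: "bet_square_sum J (Suc n) \<omega> = bet_square_sum J n \<omega> + (if J n \<omega> then x n \<omega> else 0)\<^sup>2"
  by (simp add: bet_square_sum_def)

text \<open>The parameter \<open>e\<close> may be negative: with \<open>e > 0\<close> the exponential grows at most like a bet, with
  \<open>- e\<close> in place of \<open>e\<close> at least like one.\<close>

definition bet_exp :: "real \<Rightarrow> real \<Rightarrow> (nat \<Rightarrow> 'a \<Rightarrow> bool) \<Rightarrow> nat \<Rightarrow> 'a \<Rightarrow> real" where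
  "bet_exp e l J n \<omega> = exp (l * bet_sum J n \<omega> - (1 + e) * l\<^sup>2 * bet_square_sum J n \<omega> / 2)"

lemma bet_exp_bounded_meas: "bounded_bet J c \<Longrightarrow> bet_exp e l J n \<in> bounded_meas n"
  unfolding bet_exp_def[abs_def]
  by (intro bounded_meas_exp bounded_meas_diff bounded_meas_cmult bounded_meas_divide
      bet_sum_bounded_meas bet_square_sum_bounded_meas)

lemma bet_exp_Suc: "bet_exp e l J (Suc n) \<omega> = bet_exp e l J n \<omega> *
    exp (l * (if J n \<omega> then x n \<omega> else 0) - (1 + e) * (l * (if J n \<omega> then x n \<omega> else 0))\<^sup>2 / 2)"
  by (simp add: bet_exp_def bet_sum_Suc bet_square_sum_Suc power_mult_distrib exp_add[symmetric] field_simps)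

lemma abs_lx:
  assumes "bounded_bet J c" "\<omega> \<in> space M" "\<bar>l\<bar> * c \<le> e / 2" "e \<ge> 0"
  shows "\<bar>l * (if J n \<omega> then x n \<omega> else 0)\<bar> \<le> e / 2"
proof (cases "J n \<omega>")
  case True
  have "\<bar>x n \<omega>\<bar> \<le> c" using x_bound[OF assms(2), of n] assms(1,2) True by (fastforce simp: bounded_bet_def)
  thus ?thesis using assms True mult_left_mono[of "\<bar>x n \<omega>\<bar>" c "\<bar>l\<bar>"] by (simp add: abs_mult)
qed (use assms in auto)

lemma bet_exp_upper:
  assumes "bounded_bet J c" "\<omega> \<in> space M" "\<bar>l\<bar> * c \<le> e / 2" "0 < e" "e \<le> 1"
  shows "bet_exp e l J (Suc n) \<omega> \<le> bet_exp e l J n \<omega> * (1 + l * (if J n \<omega> then x n \<omega> else 0))"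
  unfolding bet_exp_Suc using abs_lx[of J c \<omega> l e n] assms
  by (intro mult_left_mono exp_le_one_plus) (auto simp: bet_exp_def)

lemma bet_exp_lower:
  assumes "bounded_bet J c" "\<omega> \<in> space M" "\<bar>l\<bar> * c \<le> e / 2" "0 < e" "e \<le> 1"
  shows "bet_exp (- e) l J (Suc n) \<omega> \<ge> bet_exp (- e) l J n \<omega> * (1 + l * (if J n \<omega> then x n \<omega> else 0))"
  unfolding bet_exp_Suc using abs_lx[of J c \<omega> l e n] one_plus_le_exp[of e "l * (if J n \<omega> then x n \<omega> else 0)"] assms
  by (intro mult_left_mono) (auto simp: bet_exp_def)

lemma hedged_bet_exp:
  assumes "bounded_bet J c" "\<bar>l\<bar> * c \<le> e / 2" "0 < e" "e \<le> 1"
  shows "hedged (bet_exp e l J)"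
  unfolding hedged_def
proof (intro allI conjI)
  fix n
  have [measurable]: "Measurable.pred (F n) (J n)" using assms by (simp add: bounded_bet_def)
  show "bet_exp e l J n \<in> bounded_meas n" by (rule bet_exp_bounded_meas) fact
  show "\<exists>g\<in>bounded_meas n. \<forall>\<omega>\<in>space M. bet_exp e l J (Suc n) \<omega> \<le> bet_exp e l J n \<omega> + g \<omega> * x n \<omega>"
  proof (intro bexI ballI)
    fix \<omega> assume "\<omega> \<in> space M"
    from bet_exp_upper[OF assms(1) this assms(2-4), of n]
    show "bet_exp e l J (Suc n) \<omega> \<le> bet_exp e l J n \<omega> + (if J n \<omega> then l * bet_exp e l J n \<omega> else 0) * x n \<omega>"
      by (simp add: algebra_simps split: if_splits)
  next
    show "(\<lambda>\<omega>. if J n \<omega> then l * bet_exp e l J n \<omega> else 0) \<in> bounded_meas n"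
      using bet_exp_bounded_meas[OF assms(1)] by (intro bounded_meas_if) auto
  qed
qed

end

section \<open>The iterated logarithm\<close>

text \<open>The clock of a path is \<open>y = V\<^sup>2\<close>; in terms of it the iterated logarithm is
  \<open>ln (ln (sqrt y))\<close>, and \<open>lil_norm y\<close> is the normalizing factor of the theorem. The
  threshold \<open>1000\<close> in what follows is a convenient number above \<open>exp (exp 1)\<^sup>2\<close>, from where on the iterated
  logarithm is at least \<open>1\<close> and the maximum with \<open>exp 2\<close> has no effect.\<close>

definition lnln_sqrt :: "real \<Rightarrow> real" where "lnln_sqrt y = ln (ln (sqrt y))"

definition lil_norm :: "real \<Rightarrow> real" where
  "lil_norm y = sqrt y * sqrt (ln (ln (max (sqrt y) (exp 2))))"

lemma sqrt_ge_exp_exp: "y \<ge> 1000 \<Longrightarrow> sqrt y \<ge> exp (exp 1)"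
proof -
  assume y: "y \<ge> 1000"
  have "exp (exp 1) < exp (3::real)" using e_less_272 by simp
  also have "exp (3::real) = exp 1 * exp 1 * exp 1" by (simp add: exp_add[symmetric])
  also have "\<dots> < 2.72 * 2.72 * 2.72" using e_less_272 by (intro mult_strict_mono) auto
  also have "\<dots> < (30::real)" by simp
  also have "30 < sqrt (1000::real)" by (rule real_less_rsqrt) simp
  also have "\<dots> \<le> sqrt y" using y by simp
  finally show ?thesis by simp
qed

lemma lnln_sqrt_ge_1:
  assumes "y \<ge> 1000" shows "lnln_sqrt y \<ge> 1"
proof -
  have "ln (sqrt y) \<ge> exp 1" using sqrt_ge_exp_exp[OF assms] assms by (subst ln_ge_iff) auto
  hence "ln (ln (sqrt y)) \<ge> 1" by (subst ln_ge_iff) (auto intro: less_le_trans[OF exp_gt_zero])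
  thus ?thesis by (simp add: lnln_sqrt_def)
qed

lemma lil_norm_eq:
  assumes "y \<ge> 1000" shows "lil_norm y = sqrt (y * lnln_sqrt y)"
proof -
  have "exp 2 < exp (exp (1::real))" using exp_lower_Taylor_quadratic[of "1::real"] by simp
  hence "sqrt y \<ge> exp 2" using sqrt_ge_exp_exp[OF assms] by linarith
  thus ?thesis by (simp add: lil_norm_def lnln_sqrt_def real_sqrt_mult max_def)
qed

lemma lil_norm_pos: "y \<ge> 1000 \<Longrightarrow> lil_norm y > 0"
  using lnln_sqrt_ge_1[of y] by (simp add: lil_norm_eq)

lemma lnln_sqrt_mono:
  assumes "1000 \<le> y" "y \<le> z" shows "lnln_sqrt y \<le> lnln_sqrt z"
proof -
  have y: "sqrt y \<ge> exp (exp 1)" using sqrt_ge_exp_exp[OF assms(1)] .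
  hence "ln (sqrt y) \<ge> exp 1" using assms by (subst ln_ge_iff) auto
  hence "ln (sqrt y) > 0" by (rule less_le_trans[OF exp_gt_zero])
  moreover have "ln (sqrt y) \<le> ln (sqrt z)" using assms by (intro ln_mono) auto
  ultimately show ?thesis unfolding lnln_sqrt_def by (intro ln_mono[of "ln (sqrt y)" "ln (sqrt z)"])
qed

lemma lnln_sqrt_antimono:
  assumes "1000 \<le> y" "y \<le> z" shows "y * lnln_sqrt z \<le> z * lnln_sqrt y"
proof -
  have "sqrt y * lnln_sqrt z \<le> sqrt z * lnln_sqrt y"
    unfolding lnln_sqrt_def using sqrt_ge_exp_exp[OF assms(1)] assms by (intro ln_ln_over_antimono) auto
  hence "sqrt y * (sqrt y * lnln_sqrt z) \<le> sqrt y * (sqrt z * lnln_sqrt y)"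
    using assms by (intro mult_left_mono) auto
  also have "\<dots> \<le> sqrt z * (sqrt z * lnln_sqrt y)"
    using assms lnln_sqrt_ge_1[OF assms(1)] by (intro mult_right_mono) auto
  finally show ?thesis using assms by (simp add: mult.assoc[symmetric])
qed

text \<open>On the \<open>k\<close>-th geometric block the iterated logarithm is \<open>ln k\<close> up to a factor close to \<open>1\<close>. The
  factor \<open>2\<close> in the upper end of the block leaves room for the step that leaves it.\<close>

lemma lnln_sqrt_block:
  assumes r: "1 < r" and c: "0 < c"
  shows "\<forall>\<^sub>F k in sequentially. \<forall>y. r ^ k \<le> y \<longrightarrow> y \<le> 2 * r ^ (k + 1) \<longrightarrow>
     (1 - c) * ln (real k) \<le> lnln_sqrt y \<and> lnln_sqrt y \<le> (1 + c) * ln (real k)"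
proof -
  define L where "L = ln r"
  have L: "L > 0" using r by (simp add: L_def)
  have 1: "\<forall>\<^sub>F k in sequentially. (1 - c) * ln (real k) \<le> ln (real k * L / 2)"
    using c L by real_asymp
  have 2: "\<forall>\<^sub>F k in sequentially. ln ((ln 2 + (real k + 1) * L) / 2) \<le> (1 + c) * ln (real k)"
    using c L by real_asymp
  have 3: "\<forall>\<^sub>F k in sequentially. r ^ k \<ge> 1000"
    using r by real_asymp
  show ?thesis using 1 2 3
  proof eventually_elim
    case (elim k)
    show ?case
    proof (intro allI impI)
      fix y assume y: "r ^ k \<le> y" "y \<le> 2 * r ^ (k + 1)"
      have "lnln_sqrt (r ^ k) \<le> lnln_sqrt y" "lnln_sqrt y \<le> lnln_sqrt (2 * r ^ (k + 1))"
        using elim y by (auto intro!: lnln_sqrt_mono)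
      moreover have "lnln_sqrt (r ^ k) = ln (real k * L / 2)"
        using r by (simp add: lnln_sqrt_def ln_sqrt ln_realpow L_def)
      moreover have "lnln_sqrt (2 * r ^ (k + 1)) = ln ((ln 2 + (real k + 1) * L) / 2)"
      proof -
        have "ln (2 * r ^ (k + 1)) = ln 2 + (real k + 1) * L"
          using r ln_realpow[of r "k + 1"] by (subst ln_mult) (auto simp: L_def)
        thus ?thesis using r by (simp add: lnln_sqrt_def ln_sqrt)
      qed
      ultimately show "(1 - c) * ln (real k) \<le> lnln_sqrt y \<and> lnln_sqrt y \<le> (1 + c) * ln (real k)"
        using elim by linarith
    qed
  qed
qed

lemma power_block:
  fixes r y :: real
  assumes r: "1 < r" and y: "r ^ K \<le> y"
  shows "\<exists>k\<ge>K. r ^ k \<le> y \<and> y < r ^ (k + 1)"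
proof -
  define j where "j = (LEAST j. y < r ^ j)"
  have "\<exists>j. y < r ^ j" using real_arch_pow[OF r] .
  hence j: "y < r ^ j" unfolding j_def by (rule LeastI_ex)
  have least: "r ^ i \<le> y" if "i < j" for i
    using not_less_Least[of i "\<lambda>j. y < r ^ j"] that unfolding j_def by auto
  have "K < j"
  proof (rule ccontr)
    assume "\<not> K < j"
    hence "r ^ j \<le> r ^ K" using r by (intro power_increasing) auto
    thus False using j y by linarith
  qed
  thus ?thesis using j least[of "j - 1"] by (intro exI[of _ "j - 1"]) auto
qed

section \<open>Deterministic consequences for one path\<close>

text \<open>What holds along almost every path: \<open>q\<close> is \<open>V\<^sup>2\<close>, and the last assumption is the square of the
  growth condition on the bounds.\<close>

locale growing_squares =
  fixes xs bs :: "nat \<Rightarrow> real" and q :: "nat \<Rightarrow> real"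
  assumes q_eq: "\<And>n. q n = (\<Sum>i<n. (xs i)\<^sup>2)"
    and xs_le: "\<And>i. \<bar>xs i\<bar> \<le> bs i"
    and q_top: "filterlim q at_top sequentially"
    and bs_small: "(\<lambda>n. (bs n)\<^sup>2 * lnln_sqrt (q (Suc n)) / q (Suc n)) \<longlonglongrightarrow> 0"
begin

lemma q_Suc: "q (Suc n) = q n + (xs n)\<^sup>2" by (simp add: q_eq)

lemma q_mono: "m \<le> n \<Longrightarrow> q m \<le> q n"
  unfolding q_eq by (intro sum_mono2) auto

lemma q_large: "\<forall>\<^sub>F n in sequentially. C \<le> q n"
  using q_top by (simp add: filterlim_at_top)

lemma xs2_le: "(xs n)\<^sup>2 \<le> (bs n)\<^sup>2"
  using xs_le[of n] by (metis abs_ge_zero power2_abs power_mono)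

lemma bs_nonneg: "bs n \<ge> 0"
  using xs_le[of n] abs_ge_zero[of "xs n"] by linarith

lemma bs_eventually:
  assumes "c > 0"
  shows "\<forall>\<^sub>F n in sequentially. (bs n)\<^sup>2 * lnln_sqrt (q (Suc n)) \<le> c * q (Suc n)"
  using order_tendstoD(2)[OF bs_small assms] q_large[of 1000]
proof eventually_elim
  case (elim n)
  have "q (Suc n) > 0" using elim q_mono[of n "Suc n"] by linarith
  thus ?case using elim(1) by (simp add: field_simps)
qed

lemma xs_eventually:
  assumes "c > 0"
  shows "\<forall>\<^sub>F n in sequentially. (xs n)\<^sup>2 \<le> c * q (Suc n)"
  using bs_eventually[OF assms] q_large[of 1000]
proof eventually_elim
  case (elim n)
  have "lnln_sqrt (q (Suc n)) \<ge> 1" using elim q_mono[of n "Suc n"] by (intro lnln_sqrt_ge_1) auto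
  hence "(bs n)\<^sup>2 * 1 \<le> (bs n)\<^sup>2 * lnln_sqrt (q (Suc n))" by (intro mult_left_mono) auto
  thus ?case using elim xs2_le[of n] by linarith
qed

lemma q_Suc_le:
  assumes c: "0 < c" "c \<le> 1"
  shows "\<forall>\<^sub>F n in sequentially. q (Suc n) \<le> (1 + c) * q n"
  using xs_eventually[OF half_gt_zero[OF c(1)]] q_large[of 0]
proof eventually_elim
  case (elim n)
  have "q (Suc n) * (1 - c / 2) \<le> q n" using elim by (simp add: q_Suc algebra_simps)
  hence "(1 + c) * (q (Suc n) * (1 - c / 2)) \<le> (1 + c) * q n" using c by (intro mult_left_mono) auto
  moreover have "(1 + c) * (1 - c / 2) \<ge> 1" using c mult_left_le[of c c] by (simp add: algebra_simps)
  hence "q (Suc n) * 1 \<le> q (Suc n) * ((1 + c) * (1 - c / 2))"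
    using elim q_mono[of n "Suc n"] by (intro mult_left_mono) auto
  ultimately show ?case by (simp add: ac_simps)
qed

text \<open>The bounds are small compared with the scale of a block, uniformly over all times up to its
  end. For late times this is the growth condition transported by \<open>lnln_sqrt_antimono\<close> to the
  end of the block; the finitely many early bounds are harmless because \<open>r ^ k\<close> outgrows \<open>ln k\<close>.\<close>

lemma bs_block:
  assumes r: "1 < r" and d: "0 < d"
  shows "\<forall>\<^sub>F k in sequentially. \<forall>n. q n \<le> r ^ (k + 1) \<longrightarrow> ln (real k) * (bs n)\<^sup>2 \<le> d * r ^ k"
proof -
  \<comment> \<open>One factor \<open>2\<close> comes from \<open>ln k\<close> versus the iterated logarithm, the other from \<open>q (Suc n)\<close>
    versus \<open>q n\<close>, and \<open>r\<close> from \<open>r ^ (k + 1)\<close> versus \<open>r ^ k\<close>.\<close>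
  define c where "c = d / (4 * r)"
  have c: "c > 0" using r d by (simp add: c_def)
  have "\<forall>\<^sub>F n in sequentially. (bs n)\<^sup>2 * lnln_sqrt (q (Suc n)) \<le> c * q (Suc n) \<and> q (Suc n) \<le> 2 * q n \<and> 1000 \<le> q n"
    using bs_eventually[OF c] q_Suc_le[of 1] q_large[of 1000] by (simp add: eventually_conj_iff)
  then obtain N where N: "\<And>n. n \<ge> N \<Longrightarrow> (bs n)\<^sup>2 * lnln_sqrt (q (Suc n)) \<le> c * q (Suc n)"
    "\<And>n. n \<ge> N \<Longrightarrow> q (Suc n) \<le> 2 * q n" "\<And>n. n \<ge> N \<Longrightarrow> 1000 \<le> q n"
    by (auto simp: eventually_sequentially)
  define B where "B = (\<Sum>n<N. (bs n)\<^sup>2)"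
  have B: "(bs n)\<^sup>2 \<le> B" if "n < N" for n
    unfolding B_def using that by (intro member_le_sum) auto
  have 1: "\<forall>\<^sub>F k in sequentially. ln (real k) * B \<le> d * r ^ k" using r d by real_asymp
  have 2: "\<forall>\<^sub>F k in sequentially. ln (real k) > 0" by real_asymp
  show ?thesis using 1 2 lnln_sqrt_block[OF r, of "1/2", simplified]
  proof eventually_elim
    case (elim k)
    show ?case
    proof (intro allI impI)
      fix n assume n: "q n \<le> r ^ (k + 1)"
      show "ln (real k) * (bs n)\<^sup>2 \<le> d * r ^ k"
      proof (cases "n < N")
        case True
        have "ln (real k) * (bs n)\<^sup>2 \<le> ln (real k) * B" using B[OF True] elim by (intro mult_left_mono) auto
        thus ?thesis using elim by linarith
      next
        case False
        hence n': "n \<ge> N" by simp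
        let ?y = "r ^ (k + 1)"
        have q0: "q n \<ge> 1000" "q (Suc n) \<ge> q n" using N(3)[OF n'] q_mono by auto
        have "ln (real k) \<le> 2 * lnln_sqrt ?y" using elim(3)[rule_format, of ?y] r by auto
        hence "ln (real k) * (bs n)\<^sup>2 * q n \<le> 2 * lnln_sqrt ?y * (bs n)\<^sup>2 * q n"
          using q0 by (intro mult_right_mono) auto
        also have "\<dots> = 2 * (bs n)\<^sup>2 * (q n * lnln_sqrt ?y)" by simp
        also have "\<dots> \<le> 2 * (bs n)\<^sup>2 * (?y * lnln_sqrt (q n))"
          using lnln_sqrt_antimono[OF q0(1) n] by (intro mult_left_mono) auto
        also have "\<dots> \<le> 2 * (bs n)\<^sup>2 * (?y * lnln_sqrt (q (Suc n)))"
          using lnln_sqrt_mono[OF q0] r by (intro mult_left_mono) auto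
        also have "\<dots> = 2 * ?y * ((bs n)\<^sup>2 * lnln_sqrt (q (Suc n)))" by simp
        also have "\<dots> \<le> 2 * ?y * (c * (2 * q n))"
          using order_trans[OF N(1)[OF n'] mult_left_mono[OF N(2)[OF n'], of c]] c r by (intro mult_left_mono) auto
        also have "\<dots> = d * r ^ k * q n" using r by (simp add: c_def)
        finally show ?thesis using q0 by simp
      qed
    qed
  qed
qed

lemma bs_block_sqrt:
  assumes r: "1 < r" and d: "0 < d" and K: "0 < K"
  shows "\<forall>\<^sub>F k in sequentially. \<forall>n. q n \<le> r ^ (k + 1) \<longrightarrow> bs n \<le> d / sqrt (K * ln (real k) / r ^ k)"
proof -
  have 2: "\<forall>\<^sub>F k in sequentially. ln (real k) > 0" by real_asymp
  have d2: "d\<^sup>2 / K > 0" using d K by simp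
  show ?thesis using bs_block[OF r d2] 2
  proof eventually_elim
    case (elim k)
    show ?case
    proof (intro allI impI)
      fix n assume "q n \<le> r ^ (k + 1)"
      hence "ln (real k) * (bs n)\<^sup>2 \<le> d\<^sup>2 / K * r ^ k" using elim by blast
      hence "(bs n)\<^sup>2 * (K * ln (real k) / r ^ k) \<le> d\<^sup>2" using r K by (simp add: field_simps)
      hence "sqrt ((bs n)\<^sup>2 * (K * ln (real k) / r ^ k)) \<le> sqrt (d\<^sup>2)" by (rule real_sqrt_le_mono)
      hence "bs n * sqrt (K * ln (real k) / r ^ k) \<le> d"
        using bs_nonneg[of n] d by (simp only: real_sqrt_mult real_sqrt_abs abs_of_nonneg less_imp_le)
      thus "bs n \<le> d / sqrt (K * ln (real k) / r ^ k)"
        using elim r K by (subst pos_le_divide_eq) auto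
    qed
  qed
qed

text \<open>Late blocks meet the condition on the bounds by \<open>bs_block_sqrt\<close>, and passing from \<open>ln k\<close> to the
  iterated logarithm costs the second factor \<open>1 + h\<close>.\<close>

lemma upper_path:
  assumes r: "1 < r" and h: "0 < h" and e: "0 < e"
    and ev: "\<forall>\<^sub>F k in sequentially. \<forall>n. r ^ k \<le> q n \<longrightarrow> q n \<le> r ^ (k + 1) \<longrightarrow>
      (\<forall>i<n. bs i \<le> e / 2 / sqrt (2 * ln (real k) / r ^ k)) \<longrightarrow> s n < (1 + h) * sqrt (2 * ln (real k) * q n)"
  shows "\<forall>\<^sub>F n in sequentially. s n \<le> (1 + h)\<^sup>2 * sqrt 2 * lil_norm (q n)"
proof -
  define c where "c = 1 - 1 / (1 + h)\<^sup>2"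
  have c: "c > 0" using h power_strict_mono[of 1 "1 + h" 2] by (simp add: c_def)
  have e2: "e / 2 > 0" using e by simp
  have "\<forall>\<^sub>F k in sequentially. \<forall>n. r ^ k \<le> q n \<longrightarrow> q n \<le> r ^ (k + 1) \<longrightarrow> 1000 \<le> q n \<longrightarrow>
      s n \<le> (1 + h)\<^sup>2 * sqrt 2 * lil_norm (q n)"
    using ev bs_block_sqrt[OF r e2, of 2, simplified] lnln_sqrt_block[OF r c]
  proof eventually_elim
    case (elim k)
    show ?case
    proof (intro allI impI)
      fix n assume n: "r ^ k \<le> q n" "q n \<le> r ^ (k + 1)" "1000 \<le> q n"
      have "bs i \<le> e / 2 / sqrt (2 * ln (real k) / r ^ k)" if "i < n" for i
        using elim(2)[rule_format, of i] q_mono[of i n] n that by simp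
      hence "s n < (1 + h) * sqrt (2 * ln (real k) * q n)" using elim(1) n by blast
      also have "2 * ln (real k) * q n \<le> 2 * ((1 + h)\<^sup>2 * lnln_sqrt (q n)) * q n"
      proof -
        have "(1 - c) * ln (real k) \<le> lnln_sqrt (q n)" using elim(3)[rule_format, of "q n"] n by auto
        hence "ln (real k) \<le> (1 + h)\<^sup>2 * lnln_sqrt (q n)" using h by (simp add: c_def field_simps)
        thus ?thesis using n by (intro mult_right_mono mult_left_mono) auto
      qed
      also have "sqrt (2 * ((1 + h)\<^sup>2 * lnln_sqrt (q n)) * q n) = (1 + h) * (sqrt 2 * lil_norm (q n))"
        using h n by (simp add: lil_norm_eq real_sqrt_mult)
      finally show "s n \<le> (1 + h)\<^sup>2 * sqrt 2 * lil_norm (q n)"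
        using h by (simp add: power2_eq_square)
    qed
  qed
  then obtain K where K: "\<And>k n. k \<ge> K \<Longrightarrow> r ^ k \<le> q n \<Longrightarrow> q n \<le> r ^ (k + 1) \<Longrightarrow> 1000 \<le> q n \<Longrightarrow>
      s n \<le> (1 + h)\<^sup>2 * sqrt 2 * lil_norm (q n)"
    by (auto simp: eventually_sequentially)
  show ?thesis using q_large[of 1000] q_large[of "r ^ K"]
  proof eventually_elim
    case (elim n)
    obtain k where "k \<ge> K" "r ^ k \<le> q n" "q n < r ^ (k + 1)" using power_block[OF r elim(2)] by blast
    thus ?case using K elim by simp
  qed
qed

lemma crossing:
  obtains a where "\<And>i. i < a \<longleftrightarrow> q i < y"
proof -
  define a where "a = (LEAST i. y \<le> q i)"
  have "\<exists>i. y \<le> q i" using q_large[of y] by (auto simp: eventually_sequentially)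
  hence a: "y \<le> q a" unfolding a_def by (rule LeastI_ex)
  have "i < a \<longleftrightarrow> q i < y" for i
    using a q_mono[of a i] not_less_Least[of i "\<lambda>i. y \<le> q i"] unfolding a_def[symmetric] by force
  thus ?thesis using that by blast
qed

text \<open>The last value before the crossing is below \<open>y\<close>, and late steps enlarge \<open>q\<close> by a factor of at most
  \<open>1 + c\<close>.\<close>

lemma crossing_le:
  assumes c: "0 < c" "c \<le> 1"
  shows "\<exists>Y>0. \<forall>y\<ge>Y. \<forall>a. (\<forall>i. i < a \<longleftrightarrow> q i < y) \<longrightarrow> q a \<le> (1 + c) * y"
proof -
  obtain N where N: "\<And>n. n \<ge> N \<Longrightarrow> q (Suc n) \<le> (1 + c) * q n"
    using q_Suc_le[OF c] by (auto simp: eventually_sequentially)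
  have "q a \<le> (1 + c) * y" if "y \<ge> \<bar>q (Suc N)\<bar> + 1" "\<forall>i. i < a \<longleftrightarrow> q i < y" for y a
  proof -
    have "q (Suc N) < y" using that(1) by linarith
    hence "Suc N < a" using that(2) by blast
    then obtain m where m: "a = Suc m" "m \<ge> N" by (cases a) auto
    have "q a \<le> (1 + c) * q m" using N m by simp
    also have "\<dots> \<le> (1 + c) * y" using that(2) m c by (intro mult_left_mono) (auto intro: less_imp_le)
    finally show ?thesis .
  qed
  thus ?thesis by (intro exI[of _ "\<bar>q (Suc N)\<bar> + 1"]) auto
qed

text \<open>Let \<open>G = sqrt (r ^ (k + 1) * ln k)\<close>, and let \<open>a\<close> and \<open>e\<close> be the times at which \<open>q\<close> reaches the
  two ends of the block. For late blocks the differences selected by \<open>block\<close> are exactly those between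
  \<open>a\<close> and \<open>e\<close>, so a hit says that \<open>s e - s a\<close> is at least nearly
  \<open>sqrt \<kappa> * (1 - t) * (1 - 2 / r) * G\<close>. By the crude lower bound \<open>low\<close>, \<open>s a\<close> is at least
  \<open>- 4 / sqrt r * G\<close>, while \<open>lil_norm (q e)\<close> is at most \<open>(1 + t) * G\<close>.\<close>

lemma lower_path:
  fixes t r :: real
  defines "\<kappa> \<equiv> 2 / (1 + 6 * t)"
  defines "lm \<equiv> \<lambda>k. sqrt (\<kappa> * ln (real k) / r ^ (k + 1))"
  defines "block \<equiv> \<lambda>k i. r ^ k \<le> q i \<and> q i < r ^ (k + 1) \<and> bs i \<le> t\<^sup>2 / 8 / lm k"
  defines "B \<equiv> sqrt \<kappa> * (1 - t) * (1 - 2 / r) - t - 4 / sqrt r"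
  assumes t: "0 < t" "t \<le> 1" and r: "2 \<le> r" and B: "0 \<le> B"
    and s: "\<And>n. s n = (\<Sum>i<n. xs i)"
    and low: "\<forall>\<^sub>F n in sequentially. - 2 * lil_norm (q n) \<le> s n"
    and hit: "\<exists>\<^sub>F k in sequentially. \<exists>\<^sub>F n in sequentially. \<not> (\<kappa> * ln (real k) * (1 - 2 / r)
       \<le> (lm k)\<^sup>2 * (\<Sum>i<n. if block k i then (xs i)\<^sup>2 else 0) \<and>
       lm k * (\<Sum>i<n. if block k i then xs i else 0) \<le> (1 - t) * (\<kappa> * ln (real k) * (1 - 2 / r)) - ln 4 / t)"
  shows "\<exists>\<^sub>F n in sequentially. B / (1 + t) * lil_norm (q n) \<le> s n"
  unfolding frequently_sequentially
proof
  fix N0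
  have r1: "1 < r" using r by simp
  have \<kappa>: "\<kappa> > 0" using t by (simp add: \<kappa>_def)
  obtain N where N: "\<And>n. n \<ge> N \<Longrightarrow> - 2 * lil_norm (q n) \<le> s n"
    using low by (auto simp: eventually_sequentially)
  obtain Y1 where Y1: "Y1 > 0" "\<And>y a. y \<ge> Y1 \<Longrightarrow> (\<forall>i. i < a \<longleftrightarrow> q i < y) \<Longrightarrow> q a \<le> (1 + 1) * y"
    using crossing_le[of 1] by auto
  obtain Y2 where Y2: "Y2 > 0" "\<And>y a. y \<ge> Y2 \<Longrightarrow> (\<forall>i. i < a \<longleftrightarrow> q i < y) \<Longrightarrow> q a \<le> (1 + t) * y"
    using crossing_le[OF t] by blast
  \<comment> \<open>The block is so late that both ends are crossed after \<open>N\<close> and \<open>N0\<close>, with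
    overshoot by a factor of at most \<open>2\<close> and \<open>1 + t\<close> respectively.\<close>
  have big: "\<forall>\<^sub>F k in sequentially. Y1 + Y2 + 1000 + \<bar>q N\<bar> + \<bar>q N0\<bar> \<le> r ^ k" using r1 by real_asymp
  have lnk: "\<forall>\<^sub>F k in sequentially. ln (real k) > 0" by real_asymp
  \<comment> \<open>The loss \<open>t\<close> in the constant \<open>B\<close> absorbs \<open>ln 4 / t\<close>.\<close>
  have lnk2: "\<forall>\<^sub>F k in sequentially. ln 4 / t \<le> t * sqrt \<kappa> * ln (real k)" using t \<kappa> by real_asymp
  have bsb: "\<forall>\<^sub>F k in sequentially. \<forall>n. q n \<le> r ^ (k + 1) \<longrightarrow> bs n \<le> t\<^sup>2 / 8 / lm k"
    using bs_block_sqrt[OF r1, of "t\<^sup>2 / 8" "\<kappa> / r"] t r \<kappa> by (simp add: lm_def)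
  have ev: "\<forall>\<^sub>F k in sequentially. (Y1 + Y2 + 1000 + \<bar>q N\<bar> + \<bar>q N0\<bar> \<le> r ^ k \<and> ln (real k) > 0 \<and>
     ln 4 / t \<le> t * sqrt \<kappa> * ln (real k)) \<and> (\<forall>n. q n \<le> r ^ (k + 1) \<longrightarrow> bs n \<le> t\<^sup>2 / 8 / lm k) \<and>
     (\<forall>y. r ^ k \<le> y \<longrightarrow> y \<le> 2 * r ^ (k + 1) \<longrightarrow> (1 - t) * ln (real k) \<le> lnln_sqrt y \<and> lnln_sqrt y \<le> (1 + t) * ln (real k))"
    using big lnk lnk2 bsb lnln_sqrt_block[OF r1 t(1)] by eventually_elim blast
  from frequently_ex[OF frequently_eventually_frequently[OF hit ev]] obtain k where
    hit_k: "\<exists>\<^sub>F n in sequentially. \<not> (\<kappa> * ln (real k) * (1 - 2 / r)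
       \<le> (lm k)\<^sup>2 * (\<Sum>i<n. if block k i then (xs i)\<^sup>2 else 0) \<and>
       lm k * (\<Sum>i<n. if block k i then xs i else 0) \<le> (1 - t) * (\<kappa> * ln (real k) * (1 - 2 / r)) - ln 4 / t)"
    and k: "Y1 + Y2 + 1000 + \<bar>q N\<bar> + \<bar>q N0\<bar> \<le> r ^ k" "ln (real k) > 0" "ln 4 / t \<le> t * sqrt \<kappa> * ln (real k)"
    and bsk: "\<And>n. q n \<le> r ^ (k + 1) \<Longrightarrow> bs n \<le> t\<^sup>2 / 8 / lm k"
    and llk: "\<And>y. r ^ k \<le> y \<Longrightarrow> y \<le> 2 * r ^ (k + 1) \<Longrightarrow> lnln_sqrt y \<le> (1 + t) * ln (real k)"
    by blast
  define R where "R = r ^ (k + 1)"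
  have R: "R > 0" "r ^ k \<le> R" using r by (auto simp: R_def mult_le_cancel_right1)
  obtain a where a: "\<And>i. i < a \<longleftrightarrow> q i < r ^ k" by (rule crossing[of "r ^ k"]) blast
  obtain e where e: "\<And>i. i < e \<longleftrightarrow> q i < R" by (rule crossing[of R]) blast
  have ae: "a \<le> e" using a[of e] e[of e] R by (meson less_le_trans not_less order_less_irrefl)
  have qa: "r ^ k \<le> q a" "q a \<le> 2 * r ^ k" using a[of a] Y1(2)[of "r ^ k" a] a k Y2(1) by auto
  have qe: "R \<le> q e" "q e \<le> (1 + t) * R" using e[of e] Y2(2)[of R e] e k Y1(1) R by auto
  have q1000: "1000 \<le> q a" "1000 \<le> q e" using qa qe k(1) Y1(1) Y2(1) R(2) by linarith+
  have aN: "a > N" and aN0: "a > N0" using a[of N] a[of N0] k Y1(1) Y2(1) by auto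
  have block: "block k i \<longleftrightarrow> a \<le> i \<and> i < e" for i
    using a[of i] e[of i] bsk[of i] unfolding block_def R_def by auto
  obtain n where n: "n \<ge> e" "\<not> (\<kappa> * ln (real k) * (1 - 2 / r)
       \<le> (lm k)\<^sup>2 * (\<Sum>i<n. if block k i then (xs i)\<^sup>2 else 0) \<and>
       lm k * (\<Sum>i<n. if block k i then xs i else 0) \<le> (1 - t) * (\<kappa> * ln (real k) * (1 - 2 / r)) - ln 4 / t)"
    using hit_k unfolding frequently_sequentially by blast
  have sum_block: "(\<Sum>i<n. if block k i then f i else 0) = (\<Sum>i<e. f i) - (\<Sum>i<a. f i)" for f :: "nat \<Rightarrow> real"
  proof -
    have "(\<Sum>i<n. if block k i then f i else 0) = (\<Sum>i\<in>{a..<e}. f i)"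
      using n(1) by (intro sum.mono_neutral_cong_right) (auto simp: block)
    also have "\<dots> = (\<Sum>i<e. f i) - (\<Sum>i<a. f i)"
      using sum_diff_nat_ivl[of 0 a e f] ae by (simp add: atLeast0LessThan)
    finally show ?thesis .
  qed
  have lm: "lm k > 0" using k r \<kappa> by (simp add: lm_def)
  have lm2: "(lm k)\<^sup>2 * R = \<kappa> * ln (real k)" using k r \<kappa> R by (simp add: lm_def R_def)
  have "\<kappa> * ln (real k) * (1 - 2 / r) = (lm k)\<^sup>2 * (R - 2 * r ^ k)"
    unfolding lm2[symmetric] using r by (simp add: R_def field_simps)
  also have "\<dots> \<le> (lm k)\<^sup>2 * (q e - q a)" using qa qe by (intro mult_left_mono) auto
  finally have "lm k * (s e - s a) > (1 - t) * (\<kappa> * ln (real k) * (1 - 2 / r)) - ln 4 / t"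
    using n(2) unfolding sum_block s[symmetric] q_eq[symmetric] by linarith
  define G where "G = sqrt (R * ln (real k))"
  have G: "G > 0" using R k by (simp add: G_def)
  have lmG: "lm k * G = sqrt \<kappa> * ln (real k)"
  proof -
    have "lm k * G = sqrt (\<kappa> * ln (real k) / R * (R * ln (real k)))"
      unfolding lm_def G_def R_def by (rule real_sqrt_mult[symmetric])
    also have "\<kappa> * ln (real k) / R * (R * ln (real k)) = \<kappa> * (ln (real k) * ln (real k))" using R by simp
    also have "sqrt \<dots> = sqrt \<kappa> * ln (real k)" using k by (simp add: real_sqrt_mult)
    finally show ?thesis .
  qed
  have "lm k * (G * (sqrt \<kappa> * (1 - t) * (1 - 2 / r) - t))
      = (sqrt \<kappa> * sqrt \<kappa>) * ln (real k) * (1 - t) * (1 - 2 / r) - t * sqrt \<kappa> * ln (real k)"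
  proof -
    have "z * l * (z * (1 - t) * w - t) = (z * z) * l * (1 - t) * w - t * z * l" for z l w :: real
      by (simp add: algebra_simps)
    thus ?thesis unfolding mult.assoc[symmetric, of "lm k" G] lmG by blast
  qed
  also have "\<dots> \<le> (1 - t) * (\<kappa> * ln (real k) * (1 - 2 / r)) - ln 4 / t"
    using k(3) \<kappa> by (simp add: ac_simps)
  also have "\<dots> \<le> lm k * (s e - s a)" by (rule less_imp_le) fact
  finally have 1: "G * (sqrt \<kappa> * (1 - t) * (1 - 2 / r) - t) \<le> s e - s a" using lm by simp
  have "lil_norm (q a) = sqrt (q a * lnln_sqrt (q a))" using q1000 by (intro lil_norm_eq)
  also have "\<dots> \<le> sqrt ((2 * r ^ k) * (2 * ln (real k)))"
  proof (intro real_sqrt_le_mono mult_mono)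
    have "lnln_sqrt (q a) \<le> (1 + t) * ln (real k)" using qa R by (intro llk) (auto simp: R_def)
    also have "\<dots> \<le> 2 * ln (real k)" using t k by (intro mult_right_mono) auto
    finally show "lnln_sqrt (q a) \<le> 2 * ln (real k)" .
    show "0 \<le> lnln_sqrt (q a)" using lnln_sqrt_ge_1[OF q1000(1)] by simp
  qed (use qa r in auto)
  also have "(2 * r ^ k) * (2 * ln (real k)) = (2\<^sup>2 * (R * ln (real k))) / r"
    using r by (simp add: R_def)
  also have "sqrt \<dots> = 2 * G / sqrt r" unfolding G_def real_sqrt_divide real_sqrt_mult real_sqrt_abs by simp
  finally have nqa: "lil_norm (q a) \<le> 2 * G / sqrt r" .
  have 2: "- 4 / sqrt r * G \<le> s a"
  proof -
    have "- 4 / sqrt r * G = - 2 * (2 * G / sqrt r)" by simp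
    also have "\<dots> \<le> - 2 * lil_norm (q a)" using nqa by simp
    also have "\<dots> \<le> s a" using N[of a] aN by simp
    finally show ?thesis .
  qed
  have 3: "G * B \<le> s e" using 1 2 unfolding B_def by (simp add: algebra_simps)
  have "lil_norm (q e) = sqrt (q e * lnln_sqrt (q e))" using q1000 by (intro lil_norm_eq)
  also have "\<dots> \<le> sqrt (((1 + t) * R) * ((1 + t) * ln (real k)))"
  proof (intro real_sqrt_le_mono mult_mono)
    have "(1 + t) * R \<le> 2 * R" using t R by (intro mult_right_mono) auto
    thus "lnln_sqrt (q e) \<le> (1 + t) * ln (real k)" using qe R by (intro llk) (auto simp: R_def)
    show "0 \<le> lnln_sqrt (q e)" using lnln_sqrt_ge_1[OF q1000(2)] by simp
  qed (use qe R t in auto)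
  also have "((1 + t) * R) * ((1 + t) * ln (real k)) = (1 + t)\<^sup>2 * (R * ln (real k))"
    by (simp add: power2_eq_square)
  also have "sqrt \<dots> = (1 + t) * G" unfolding G_def real_sqrt_mult real_sqrt_abs using t by simp
  finally have "B / (1 + t) * lil_norm (q e) \<le> B / (1 + t) * ((1 + t) * G)"
    using B t by (intro mult_left_mono) auto
  also have "\<dots> = G * B" using t by simp
  finally have "B / (1 + t) * lil_norm (q e) \<le> s e" using 3 by simp
  thus "\<exists>n\<ge>N0. B / (1 + t) * lil_norm (q n) \<le> s n" using ae aN0 by (intro exI[of _ e]) auto
qed

text \<open>The change splits into the new difference, which is small relative to the normalizer, and the
  bounded old quotient times the relative change of the normalizer. By \<open>lnln_sqrt_antimono\<close> the normalizer
  changes by a factor of at least \<open>q n / q (Suc n)\<close>, which tends to \<open>1\<close>.\<close>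

lemma increments:
  assumes s: "\<And>n. s n = (\<Sum>i<n. xs i)" and bd: "\<forall>\<^sub>F n in sequentially. \<bar>s n\<bar> \<le> 2 * lil_norm (q n)"
  shows "(\<lambda>n. s (Suc n) / lil_norm (q (Suc n)) - s n / lil_norm (q n)) \<longlonglongrightarrow> 0"
proof (rule Lim_null_comparison)
  define u where "u n = sqrt ((bs n)\<^sup>2 * lnln_sqrt (q (Suc n)) / q (Suc n))" for n
  have "u \<longlonglongrightarrow> 0" using tendsto_real_sqrt[OF bs_small] by (simp add: u_def[abs_def])
  hence "(\<lambda>n. u n + 2 * (u n)\<^sup>2) \<longlonglongrightarrow> 0 + 2 * 0\<^sup>2" by (intro tendsto_intros)
  thus "(\<lambda>n. u n + 2 * (u n)\<^sup>2) \<longlonglongrightarrow> 0" by simp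
  show "\<forall>\<^sub>F n in sequentially. norm (s (Suc n) / lil_norm (q (Suc n)) - s n / lil_norm (q n)) \<le> u n + 2 * (u n)\<^sup>2"
    using bd q_large[of 1000]
  proof eventually_elim
    case (elim n)
    let ?y = "q n" and ?z = "q (Suc n)"
    have yz: "1000 \<le> ?y" "?y \<le> ?z" "1000 \<le> ?z" using elim q_mono[of n "Suc n"] by auto
    note ll1 = lnln_sqrt_ge_1[OF yz(1)] lnln_sqrt_ge_1[OF yz(3)]
    note np = lil_norm_pos[OF yz(1)] lil_norm_pos[OF yz(3)]
    have u2: "(u n)\<^sup>2 = (bs n)\<^sup>2 * lnln_sqrt ?z / ?z" using ll1 yz by (simp add: u_def)
    have x2: "(xs n)\<^sup>2 / ?z \<le> (u n)\<^sup>2"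
    proof -
      have "(xs n)\<^sup>2 * 1 \<le> (bs n)\<^sup>2 * lnln_sqrt ?z" using xs2_le[of n] ll1 by (intro mult_mono) auto
      thus ?thesis unfolding u2 using yz by (intro divide_right_mono) auto
    qed
    have u0: "u n \<ge> 0" using ll1 yz by (simp add: u_def)
    have x1: "\<bar>xs n\<bar> / lil_norm ?z \<le> u n"
    proof (rule power2_le_imp_le[OF _ u0])
      have "(\<bar>xs n\<bar> / lil_norm ?z)\<^sup>2 = (xs n)\<^sup>2 / (?z * lnln_sqrt ?z)"
        using yz ll1 by (simp add: lil_norm_eq power_divide)
      also have "\<dots> \<le> (xs n)\<^sup>2 / (?z * 1)"
        using yz ll1 by (intro divide_left_mono mult_left_mono) auto
      finally show "(\<bar>xs n\<bar> / lil_norm ?z)\<^sup>2 \<le> (u n)\<^sup>2" using x2 by simp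
    qed
    have le1: "lil_norm ?y / lil_norm ?z \<le> 1"
      using yz ll1 lnln_sqrt_mono[OF yz(1,2)] np by (auto simp: lil_norm_eq intro!: mult_mono)
    have ge: "lil_norm ?y / lil_norm ?z \<ge> ?y / ?z"
    proof (rule power2_le_imp_le)
      have "?y * ?y * lnln_sqrt ?z \<le> ?y * (?z * lnln_sqrt ?y)"
        unfolding mult.assoc using lnln_sqrt_antimono[OF yz(1,2)] yz by (intro mult_left_mono) auto
      hence "(?y / ?z)\<^sup>2 \<le> (?y * lnln_sqrt ?y) / (?z * lnln_sqrt ?z)"
        using yz ll1 by (simp add: field_simps power2_eq_square)
      thus "(?y / ?z)\<^sup>2 \<le> (lil_norm ?y / lil_norm ?z)\<^sup>2" using yz ll1 by (simp add: lil_norm_eq power_divide)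
    qed (use np in auto)
    have "?y / ?z = 1 - (xs n)\<^sup>2 / ?z" using yz by (simp add: q_Suc field_simps)
    hence r1: "\<bar>lil_norm ?y / lil_norm ?z - 1\<bar> \<le> (u n)\<^sup>2" using ge le1 x2 by linarith
    have "s (Suc n) / lil_norm ?z - s n / lil_norm ?y = xs n / lil_norm ?z + s n / lil_norm ?y * (lil_norm ?y / lil_norm ?z - 1)"
      using np by (simp add: s field_simps)
    also have "\<bar>\<dots>\<bar> \<le> \<bar>xs n / lil_norm ?z\<bar> + \<bar>s n / lil_norm ?y\<bar> * \<bar>lil_norm ?y / lil_norm ?z - 1\<bar>"
      by (metis abs_mult abs_triangle_ineq)
    also have "\<dots> \<le> u n + 2 * (u n)\<^sup>2"
    proof (intro add_mono mult_mono)
      show "\<bar>s n / lil_norm ?y\<bar> \<le> 2" using elim np by (simp add: divide_le_eq)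
    qed (use x1 r1 np in auto)
    finally show ?case by simp
  qed
qed

end

section \<open>Upper bound for blocks\<close>

context bounded_fair_game
begin

definition S :: "nat \<Rightarrow> 'a \<Rightarrow> real" where "S n \<omega> = (\<Sum>i<n. x i \<omega>)"
definition Sq :: "nat \<Rightarrow> 'a \<Rightarrow> real" where "Sq n \<omega> = (\<Sum>i<n. (x i \<omega>)\<^sup>2)"

lemma x_measurable_le: "i < n \<Longrightarrow> x i \<in> borel_measurable (F n)"
proof (induction n)
  case (Suc n)
  thus ?case using x_measurable measurable_F_Suc by (cases "i = n") auto
qed simp

lemma S_measurable: "S n \<in> borel_measurable (F n)"
  unfolding S_def[abs_def] using x_measurable_le by (intro borel_measurable_sum) auto

lemma Sq_measurable: "Sq n \<in> borel_measurable (F n)"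
  unfolding Sq_def[abs_def] using x_measurable_le by (intro borel_measurable_sum borel_measurable_power) auto

lemma bet_square_sum_le: "bet_square_sum J n \<omega> \<le> Sq n \<omega>"
  unfolding bet_square_sum_def Sq_def by (intro sum_mono) auto

text \<open>With \<open>l\<^sup>2 r ^ k = 2 ln k\<close>, the event forces
  \<open>l S - (1 + e) l\<^sup>2 V\<^sup>2 / 2 \<ge> 2 (1 + h) ln k - (1 + e) r ln k \<ge> (1 + h) ln k\<close>, and the maximal inequality
  applies to the exponential of the left-hand side. The condition on the bounds is built into the bet,
  which skips every difference whose bound is too large.\<close>

lemma upper_block_prob:
  assumes r: "1 < r" and e: "0 < e" "e \<le> 1" and re: "(1 + e) * r \<le> 1 + h" and k: "2 \<le> (k::nat)"
  defines "l \<equiv> sqrt (2 * ln k / r ^ k)"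
  shows "prob {\<omega>\<in>space M. \<exists>n. r ^ k \<le> Sq n \<omega> \<and> Sq n \<omega> \<le> r ^ (k + 1)
      \<and> S n \<omega> \<ge> (1 + h) * sqrt (2 * ln k * Sq n \<omega>) \<and> (\<forall>i<n. b i \<omega> \<le> e / 2 / l)} \<le> real k powr (- (1 + h))"
    (is "prob ?E \<le> _")
proof -
  have lnk: "ln (real k) > 0" using k by simp
  have l: "l > 0" using lnk r by (simp add: l_def)
  have l2: "l\<^sup>2 * r ^ k = 2 * ln k" using lnk r by (simp add: l_def)
  have h: "h > 0" using re mult_strict_mono[of 1 "1 + e" 1 r] e r by auto
  define J where "J i \<omega> = (b i \<omega> \<le> e / 2 / l)" for i \<omega>
  have J: "bounded_bet J (e / 2 / l)"
    unfolding bounded_bet_def J_def using b_measurable by auto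
  have lc: "\<bar>l\<bar> * (e / 2 / l) \<le> e / 2" using l by simp
  define K where "K = exp ((1 + h) * ln k)"
  have *: "\<exists>n. bet_exp e l J n \<omega> \<ge> K" if "\<omega> \<in> ?E" for \<omega>
  proof -
    from that obtain n where n: "r ^ k \<le> Sq n \<omega>" "Sq n \<omega> \<le> r ^ (k + 1)"
      "S n \<omega> \<ge> (1 + h) * sqrt (2 * ln k * Sq n \<omega>)" "\<forall>i<n. b i \<omega> \<le> e / 2 / l" by auto
    have US: "bet_sum J n \<omega> = S n \<omega>" and QS: "bet_square_sum J n \<omega> = Sq n \<omega>"
      unfolding bet_sum_def S_def bet_square_sum_def Sq_def J_def using n(4) by (auto intro!: sum.cong)
    have "2 * ln k = sqrt ((2 * ln k) * (2 * ln k))" using lnk by (subst real_sqrt_abs2) simp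
    also have "\<dots> = sqrt (l\<^sup>2 * (2 * ln k * r ^ k))" by (simp add: l2[symmetric] ac_simps)
    also have "\<dots> = l * sqrt (2 * ln k * r ^ k)" using l by (simp add: real_sqrt_mult)
    also have "\<dots> \<le> l * sqrt (2 * ln k * Sq n \<omega>)" using l n(1) lnk by (intro mult_left_mono) auto
    finally have "(1 + h) * (2 * ln k) \<le> (1 + h) * (l * sqrt (2 * ln k * Sq n \<omega>))"
      using h by (intro mult_left_mono) auto
    also have "\<dots> = l * ((1 + h) * sqrt (2 * ln k * Sq n \<omega>))" by simp
    also have "\<dots> \<le> l * S n \<omega>" using l n(3) by (intro mult_left_mono) auto
    finally have 1: "(1 + h) * (2 * ln k) \<le> l * S n \<omega>" .
    have "(1 + e) * l\<^sup>2 * Sq n \<omega> \<le> (1 + e) * l\<^sup>2 * r ^ (k + 1)"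
      using n(2) e by (intro mult_left_mono) auto
    also have "\<dots> = (1 + e) * r * (2 * ln k)" by (simp add: l2[symmetric])
    also have "\<dots> \<le> (1 + h) * (2 * ln k)" using re lnk by (intro mult_right_mono) auto
    finally have "(1 + h) * ln k \<le> l * S n \<omega> - (1 + e) * l\<^sup>2 * Sq n \<omega> / 2" using 1 by (simp add: field_simps)
    hence "K \<le> bet_exp e l J n \<omega>" unfolding K_def bet_exp_def US QS by simp
    thus ?thesis ..
  qed
  have hed: "hedged (bet_exp e l J)" by (rule hedged_bet_exp[OF J lc e])
  have [measurable]: "bet_exp e l J n \<in> borel_measurable M" for n
    using bet_exp_bounded_meas[OF J] bounded_meas_measurable measurable_F_M by blast
  have "prob ?E \<le> prob {\<omega>\<in>space M. \<exists>n. bet_exp e l J n \<omega> \<ge> K}"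
    using * by (intro finite_measure_mono) auto
  also have "\<dots> \<le> 1 / K"
    by (rule hedged_maximal[OF hed]) (auto simp: bet_exp_def K_def bet_sum_def bet_square_sum_def)
  also have "1 / K = real k powr (- (1 + h))"
    unfolding powr_minus_divide using k by (simp add: K_def powr_def)
  finally show ?thesis .
qed

lemma upper_AE:
  assumes r: "1 < r" and e: "0 < e" "e \<le> 1" and re: "(1 + e) * r \<le> 1 + h"
  shows "AE \<omega> in M. \<forall>\<^sub>F k in sequentially. \<forall>n. r ^ k \<le> Sq n \<omega> \<longrightarrow> Sq n \<omega> \<le> r ^ (k + 1) \<longrightarrow>
      (\<forall>i<n. b i \<omega> \<le> e / 2 / sqrt (2 * ln k / r ^ k)) \<longrightarrow> S n \<omega> < (1 + h) * sqrt (2 * ln k * Sq n \<omega>)"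
proof -
  have h: "h > 0" using re mult_strict_mono[of 1 "1 + e" 1 r] e r by auto
  define E where "E k = {\<omega>\<in>space M. \<exists>n. r ^ k \<le> Sq n \<omega> \<and> Sq n \<omega> \<le> r ^ (k + 1)
      \<and> S n \<omega> \<ge> (1 + h) * sqrt (2 * ln k * Sq n \<omega>) \<and> (\<forall>i<n. b i \<omega> \<le> e / 2 / sqrt (2 * ln k / r ^ k))}" for k :: nat
  have [measurable]: "S n \<in> borel_measurable M" "Sq n \<in> borel_measurable M" "b n \<in> borel_measurable M" for n
    using S_measurable Sq_measurable b_measurable measurable_F_M by blast+
  have E: "E k \<in> sets M" for k unfolding E_def by measurable
  have "summable (\<lambda>k. real k powr (- (1 + h)))" using h by (simp add: summable_real_powr_iff)
  hence "summable (\<lambda>k. prob (E k))"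
  proof (rule summable_comparison_test_ev[rotated])
    show "\<forall>\<^sub>F k in sequentially. norm (prob (E k)) \<le> real k powr (- (1 + h))"
      using eventually_ge_at_top[of "2::nat"]
    proof eventually_elim
      case (elim k)
      show ?case using upper_block_prob[OF r e re elim] by (simp add: E_def)
    qed
  qed
  hence "AE \<omega> in M. \<forall>\<^sub>F k in sequentially. \<omega> \<in> space M - E k"
    using E by (intro borel_cantelli_AE1) (auto simp: emeasure_eq_measure)
  thus ?thesis
  proof eventually_elim
    case (elim \<omega>)
    thus ?case
    proof eventually_elim
      case (elim k)
      thus ?case unfolding E_def Diff_iff mem_Collect_eq not_le[symmetric] by blast
    qed
  qed
qed

end

section \<open>Exponential tilting\<close>

text \<open>Think of \<open>u = l S\<close> and \<open>q = l\<^sup>2 V\<^sup>2\<close>, and let \<open>e = t\<^sup>2 / 2\<close>. The first exponential reweights towards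
  paths with \<open>u\<close> near \<open>q\<close>. The other two, with \<open>l\<close> replaced by \<open>(1 - t) l\<close> and \<open>(1 + t) l\<close>, exceed
  it when \<open>u\<close> is well below or well above \<open>q\<close>, so the difference can be positive only for \<open>u\<close> near \<open>q\<close>,
  where the first term is about \<open>exp (q / 2)\<close>. The slack \<open>e\<close> must be of smaller order than
  \<open>t\<close>, and the weights \<open>1 / 4\<close> leave the value \<open>1 / 2\<close> at the start.\<close>

definition tilt :: "real \<Rightarrow> real \<Rightarrow> real \<Rightarrow> real" where
  "tilt t u q = exp (u - (1 - t\<^sup>2 / 2) * q / 2)
     - exp ((1 - t) * u - (1 + t\<^sup>2 / 2) * (1 - t)\<^sup>2 * q / 2) / 4
     - exp ((1 + t) * u - (1 + t\<^sup>2 / 2) * (1 + t)\<^sup>2 * q / 2) / 4"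

lemma tilt_0: "tilt t 0 0 = 1 / 2"
  by (simp add: tilt_def)

lemma quarter_exp: "exp (ln 4 + a) / 4 = exp (a::real)"
  by (simp add: exp_add)

lemma tilt_exponent_down: "2 * z * q \<le> (A - B) * q \<Longrightarrow> t * u \<le> z * q - l
    \<Longrightarrow> u - A * q / 2 + l \<le> (1 - t) * u - B * q / 2"
  for t :: real by (simp add: algebra_simps)

lemma tilt_exponent_up: "(B - A) * q \<le> 2 * z * q \<Longrightarrow> z * q + l \<le> t * u
    \<Longrightarrow> u - A * q / 2 + l \<le> (1 + t) * u - B * q / 2"
  for t :: real by (simp add: algebra_simps)

text \<open>For small \<open>u\<close> the exponential with parameter \<open>1 - t\<close> dominates.\<close>

lemma tilt_nonpos:
  assumes t: "0 < t" "t \<le> 1" and q: "0 \<le> q" and u: "u \<le> (1 - t) * q - ln 4 / t"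
  shows "tilt t u q \<le> 0"
proof -
  have "t * u \<le> t * ((1 - t) * q - ln 4 / t)" using u t by (intro mult_left_mono) auto
  hence *: "t * u \<le> t * (1 - t) * q - ln 4" using t by (simp add: algebra_simps)
  have "t\<^sup>2 / 2 * ((1 - t)\<^sup>2 + 1) \<le> t\<^sup>2 / 2 * 2"
    using t power_le_one[of "1 - t" 2] by (intro mult_left_mono) auto
  hence "(1 - t\<^sup>2 / 2) - (1 + t\<^sup>2 / 2) * (1 - t)\<^sup>2 \<ge> 2 * (t * (1 - t))"
    by (simp add: power2_eq_square algebra_simps)
  hence "((1 - t\<^sup>2 / 2) - (1 + t\<^sup>2 / 2) * (1 - t)\<^sup>2) * q \<ge> 2 * (t * (1 - t)) * q"
    using q by (rule mult_right_mono)
  hence "u - (1 - t\<^sup>2 / 2) * q / 2 + ln 4 \<le> (1 - t) * u - (1 + t\<^sup>2 / 2) * (1 - t)\<^sup>2 * q / 2"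
    using * tilt_exponent_down by blast
  hence "exp (u - (1 - t\<^sup>2 / 2) * q / 2) \<le> exp ((1 - t) * u - (1 + t\<^sup>2 / 2) * (1 - t)\<^sup>2 * q / 2) / 4"
    using quarter_exp[of "u - (1 - t\<^sup>2 / 2) * q / 2"]
    by (metis add.commute divide_right_mono exp_le_cancel_iff zero_le_numeral)
  moreover have "exp ((1 + t) * u - (1 + t\<^sup>2 / 2) * (1 + t)\<^sup>2 * q / 2) \<ge> 0" by simp
  ultimately show ?thesis unfolding tilt_def by linarith
qed

text \<open>For large \<open>u\<close> the exponential with parameter \<open>1 + t\<close> dominates; otherwise \<open>u\<close> is at most
  \<open>(1 + 2 t) q + ln 4 / t\<close>, which bounds the first exponential. The bound must hold for all \<open>q\<close> up to \<open>h\<close>, as it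
  is used while the block is still in progress.\<close>

lemma tilt_le:
  assumes t: "0 < t" "t \<le> 1" and q: "0 \<le> q" "q \<le> h"
  shows "tilt t u q \<le> exp (h * (1 / 2 + 3 * t) + ln 4 / t)"
proof (cases "u \<ge> (1 + 2 * t) * q + ln 4 / t")
  case True
  have "t * u \<ge> t * ((1 + 2 * t) * q + ln 4 / t)" using True t by (intro mult_left_mono) auto
  hence *: "t * u \<ge> t * (1 + 2 * t) * q + ln 4" using t by (simp add: algebra_simps)
  have "t\<^sup>2 / 2 * ((1 + t)\<^sup>2 + 1) \<le> t\<^sup>2 / 2 * 5"
    using t power_mono[of "1 + t" 2 2] by (intro mult_left_mono) auto
  hence "(1 + t\<^sup>2 / 2) * (1 + t)\<^sup>2 - (1 - t\<^sup>2 / 2) \<le> 2 * t + 7 / 2 * t\<^sup>2"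
    by (simp add: power2_eq_square algebra_simps)
  also have "\<dots> \<le> 2 * (t * (1 + 2 * t))" by (simp add: power2_eq_square algebra_simps)
  finally have "((1 + t\<^sup>2 / 2) * (1 + t)\<^sup>2 - (1 - t\<^sup>2 / 2)) * q \<le> 2 * (t * (1 + 2 * t)) * q"
    using q(1) by (rule mult_right_mono)
  hence "u - (1 - t\<^sup>2 / 2) * q / 2 + ln 4 \<le> (1 + t) * u - (1 + t\<^sup>2 / 2) * (1 + t)\<^sup>2 * q / 2"
    using * tilt_exponent_up by blast
  hence "exp (u - (1 - t\<^sup>2 / 2) * q / 2) \<le> exp ((1 + t) * u - (1 + t\<^sup>2 / 2) * (1 + t)\<^sup>2 * q / 2) / 4"
    using quarter_exp[of "u - (1 - t\<^sup>2 / 2) * q / 2"]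
    by (metis add.commute divide_right_mono exp_le_cancel_iff zero_le_numeral)
  moreover have "exp ((1 - t) * u - (1 + t\<^sup>2 / 2) * (1 - t)\<^sup>2 * q / 2) \<ge> 0" by simp
  moreover have "exp (h * (1 / 2 + 3 * t) + ln 4 / t) \<ge> 0" by simp
  ultimately show ?thesis unfolding tilt_def by linarith
next
  case False
  have "t\<^sup>2 \<le> t" using t by (simp add: power2_eq_square mult_left_le)
  hence "t\<^sup>2 * q \<le> t * q" using q by (intro mult_right_mono)
  moreover have "0 \<le> t * q" using t q by simp
  moreover have "u < q + 2 * (t * q) + ln 4 / t" using False by (simp add: algebra_simps)
  moreover have "u - (1 - t\<^sup>2 / 2) * q / 2 = u - q / 2 + t\<^sup>2 * q / 4" by (simp add: field_simps)
  moreover have "q * (1 / 2 + 3 * t) = q / 2 + 3 * (t * q)" by (simp add: algebra_simps)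
  ultimately have "u - (1 - t\<^sup>2 / 2) * q / 2 \<le> q * (1 / 2 + 3 * t) + ln 4 / t" by linarith
  also have "\<dots> \<le> h * (1 / 2 + 3 * t) + ln 4 / t"
    using q t by (intro add_mono mult_right_mono) auto
  finally have "exp (u - (1 - t\<^sup>2 / 2) * q / 2) \<le> exp (h * (1 / 2 + 3 * t) + ln 4 / t)" by simp
  moreover have "exp ((1 - t) * u - (1 + t\<^sup>2 / 2) * (1 - t)\<^sup>2 * q / 2) \<ge> 0"
      "exp ((1 + t) * u - (1 + t\<^sup>2 / 2) * (1 + t)\<^sup>2 * q / 2) \<ge> 0" by simp_all
  ultimately show ?thesis unfolding tilt_def by linarith
qed

section \<open>Lower bound for blocks\<close>

lemma one_plus_sum_le_prod:
  fixes a :: "'b \<Rightarrow> real"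
  assumes "finite A" "\<And>i. i \<in> A \<Longrightarrow> a i \<ge> 0"
  shows "1 + (\<Sum>i\<in>A. a i) \<le> (\<Prod>i\<in>A. 1 + a i)"
  using assms
proof (induction A rule: finite_induct)
  case (insert i A)
  have s: "(\<Sum>i\<in>A. a i) \<ge> 0" using insert by (intro sum_nonneg) auto
  have "1 + (\<Sum>i\<in>insert i A. a i) \<le> (1 + a i) * (1 + (\<Sum>i\<in>A. a i))"
    using insert.hyps insert.prems[of i] s by (simp add: algebra_simps)
  also have "\<dots> \<le> (1 + a i) * (\<Prod>i\<in>A. 1 + a i)"
    using insert by (intro mult_left_mono) auto
  finally show ?case using insert by simp
qed simp

text \<open>If every block from \<open>k0\<close> to \<open>K\<close> is a miss, betting in each of them leads to a capital of this
  kind. It is unbounded because the harmonic series diverges.\<close>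

lemma harmonic_prod_at_top:
  fixes c :: real
  assumes "c > 0"
  shows "filterlim (\<lambda>K. \<Prod>k\<in>{k0..K}. 1 + c / real k) at_top sequentially"
proof (rule filterlim_at_top_mono)
  show "filterlim (\<lambda>K. - c * harm k0 + c * harm K) at_top sequentially"
    using assms by (intro filterlim_tendsto_add_at_top[OF tendsto_const]
        filterlim_tendsto_pos_mult_at_top[OF tendsto_const] harm_at_top)
  show "\<forall>\<^sub>F K in sequentially. - c * harm k0 + c * harm K \<le> (\<Prod>k\<in>{k0..K}. 1 + c / real k)"
  proof (rule always_eventually, rule allI)
    fix K
    have "harm K \<le> (\<Sum>k\<in>{1..k0} \<union> {k0..K}. inverse (real k))"
      unfolding harm_def by (intro sum_mono2) auto
    also have "\<dots> \<le> harm k0 + (\<Sum>k\<in>{k0..K}. inverse (real k))"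
      unfolding harm_def by (subst sum.union_inter[symmetric]) (auto intro: sum_nonneg)
    finally have "c * harm K \<le> c * (harm k0 + (\<Sum>k\<in>{k0..K}. inverse (real k)))"
      using assms by (intro mult_left_mono) auto
    also have "\<dots> = c * harm k0 + (\<Sum>k\<in>{k0..K}. c / real k)"
      by (simp add: algebra_simps sum_distrib_left divide_inverse)
    also have "(\<Sum>k\<in>{k0..K}. c / real k) \<le> (\<Prod>k\<in>{k0..K}. 1 + c / real k)"
      using one_plus_sum_le_prod[of "{k0..K}" "\<lambda>k. c / real k"] assms by simp
    finally show "- c * harm k0 + c * harm K \<le> (\<Prod>k\<in>{k0..K}. 1 + c / real k)" by simp
  qed
qed

context bounded_fair_game
begin

text \<open>At most one factor bets at any time, so the product grows at most by the stake of that factor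
  multiplied by the current values of the others, which is again an admissible stake. No product of
  two simultaneous bets arises.\<close>

lemma hedged_prod:
  assumes A: "finite A"
    and bounded_meas: "\<And>k n. k \<in> A \<Longrightarrow> C k n \<in> bounded_meas n"
    and nn: "\<And>k n \<omega>. k \<in> A \<Longrightarrow> \<omega> \<in> space M \<Longrightarrow> C k n \<omega> \<ge> 0"
    and g: "\<And>k n. k \<in> A \<Longrightarrow> g k n \<in> bounded_meas n"
    and step: "\<And>k n \<omega>. k \<in> A \<Longrightarrow> \<omega> \<in> space M \<Longrightarrow> C k (Suc n) \<omega> \<le> C k n \<omega> + g k n \<omega> * x n \<omega>"
    and inactive: "\<And>k n \<omega>. k \<in> A \<Longrightarrow> \<omega> \<in> space M \<Longrightarrow> \<not> J k n \<omega> \<Longrightarrow> g k n \<omega> = 0"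
    and disj: "\<And>j k n \<omega>. j \<in> A \<Longrightarrow> k \<in> A \<Longrightarrow> \<omega> \<in> space M \<Longrightarrow> J j n \<omega> \<Longrightarrow> J k n \<omega> \<Longrightarrow> j = k"
  shows "hedged (\<lambda>n \<omega>. \<Prod>k\<in>A. C k n \<omega>)"
  unfolding hedged_def
proof (intro allI conjI bexI ballI)
  fix n
  show "(\<lambda>\<omega>. \<Prod>k\<in>A. C k n \<omega>) \<in> bounded_meas n" using bounded_meas by auto
  show "(\<lambda>\<omega>. \<Sum>k\<in>A. g k n \<omega> * (\<Prod>j\<in>A-{k}. C j n \<omega>)) \<in> bounded_meas n"
    using bounded_meas g by (intro bounded_meas_sum bounded_meas_mult bounded_meas_prod) auto
next
  fix n \<omega> assume \<omega>: "\<omega> \<in> space M"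
  have mono: "C j (Suc n) \<omega> \<le> C j n \<omega>" if "j \<in> A" "\<not> J j n \<omega>" for j
    using step[OF that(1) \<omega>, of n] inactive[OF that(1) \<omega> that(2)] by simp
  show "(\<Prod>k\<in>A. C k (Suc n) \<omega>) \<le> (\<Prod>k\<in>A. C k n \<omega>) + (\<Sum>k\<in>A. g k n \<omega> * (\<Prod>j\<in>A-{k}. C j n \<omega>)) * x n \<omega>"
  proof (cases "\<exists>k\<in>A. J k n \<omega>")
    case False
    have "(\<Prod>k\<in>A. C k (Suc n) \<omega>) \<le> (\<Prod>k\<in>A. C k n \<omega>)"
      using False mono nn \<omega> by (intro prod_mono) auto
    moreover have "(\<Sum>k\<in>A. g k n \<omega> * (\<Prod>j\<in>A-{k}. C j n \<omega>)) = 0"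
      using False inactive \<omega> by (intro sum.neutral) auto
    ultimately show ?thesis by simp
  next
    case True
    then obtain k where k: "k \<in> A" "J k n \<omega>" by auto
    have others: "\<not> J j n \<omega>" if "j \<in> A - {k}" for j using disj[of j k] k that \<omega> by auto
    let ?P = "\<Prod>j\<in>A-{k}. C j n \<omega>"
    have sum: "(\<Sum>k\<in>A. g k n \<omega> * (\<Prod>j\<in>A-{k}. C j n \<omega>)) = g k n \<omega> * ?P"
      using others inactive \<omega> by (subst sum.remove[OF A k(1)]) (auto intro!: sum.neutral)
    have "(\<Prod>k\<in>A. C k (Suc n) \<omega>) = C k (Suc n) \<omega> * (\<Prod>j\<in>A-{k}. C j (Suc n) \<omega>)"
      by (rule prod.remove[OF A k(1)])
    also have "\<dots> \<le> C k (Suc n) \<omega> * ?P"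
      using mono others nn \<omega> k by (intro mult_left_mono prod_mono) auto
    also have "\<dots> \<le> (C k n \<omega> + g k n \<omega> * x n \<omega>) * ?P"
      using step[OF k(1) \<omega>] nn \<omega> by (intro mult_right_mono prod_nonneg) auto
    also have "\<dots> = C k n \<omega> * ?P + g k n \<omega> * ?P * x n \<omega>" by (simp add: algebra_simps)
    also have "C k n \<omega> * ?P = (\<Prod>k\<in>A. C k n \<omega>)" by (rule prod.remove[OF A k(1), symmetric])
    finally show ?thesis by (simp add: sum)
  qed
qed

definition tilted :: "real \<Rightarrow> real \<Rightarrow> (nat \<Rightarrow> 'a \<Rightarrow> bool) \<Rightarrow> nat \<Rightarrow> 'a \<Rightarrow> real" where
  "tilted t l J n \<omega> = tilt t (l * bet_sum J n \<omega>) (l\<^sup>2 * bet_square_sum J n \<omega>)"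

lemma tilted_eq: "tilted t l J n \<omega> = bet_exp (- (t\<^sup>2 / 2)) l J n \<omega> - bet_exp (t\<^sup>2 / 2) ((1 - t) * l) J n \<omega> / 4
    - bet_exp (t\<^sup>2 / 2) ((1 + t) * l) J n \<omega> / 4"
  by (simp add: tilted_def tilt_def bet_exp_def power_mult_distrib mult.assoc)

definition tilted_gain :: "real \<Rightarrow> real \<Rightarrow> (nat \<Rightarrow> 'a \<Rightarrow> bool) \<Rightarrow> nat \<Rightarrow> 'a \<Rightarrow> real" where
  "tilted_gain t l J n \<omega> = (if J n \<omega> then l * bet_exp (- (t\<^sup>2 / 2)) l J n \<omega>
     - (1 - t) * l * bet_exp (t\<^sup>2 / 2) ((1 - t) * l) J n \<omega> / 4
     - (1 + t) * l * bet_exp (t\<^sup>2 / 2) ((1 + t) * l) J n \<omega> / 4 else 0)"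

lemma tilted_bounded_meas: "bounded_bet J c \<Longrightarrow> tilted t l J n \<in> bounded_meas n"
  unfolding tilted_eq[abs_def] by (intro bounded_meas_diff bounded_meas_divide bet_exp_bounded_meas)

lemma tilted_gain_bounded_meas: "bounded_bet J c \<Longrightarrow> tilted_gain t l J n \<in> bounded_meas n"
  unfolding tilted_gain_def[abs_def]
  by (intro bounded_meas_if bounded_meas_diff bounded_meas_divide bounded_meas_cmult
      bet_exp_bounded_meas) (auto simp: bounded_bet_def)

lemma tilted_step:
  assumes J: "bounded_bet J c" and \<omega>: "\<omega> \<in> space M" and t: "0 < t" "t \<le> 1" and l: "0 < l" "l * c \<le> t\<^sup>2 / 8"
  shows "tilted t l J (Suc n) \<omega> \<ge> tilted t l J n \<omega> + tilted_gain t l J n \<omega> * x n \<omega>"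
proof -
  let ?e = "t\<^sup>2 / 2" and ?y = "if J n \<omega> then x n \<omega> else 0"
  have e: "0 < ?e" "?e \<le> 1" using t power_le_one[of t 2] by auto
  have *: "\<bar>a * l\<bar> * c \<le> ?e / 2" if "0 \<le> a" "a \<le> 2" for a
  proof -
    have "a * (l * c) \<le> a * (t\<^sup>2 / 8)" using l that by (intro mult_left_mono)
    also have "\<dots> \<le> 2 * (t\<^sup>2 / 8)" using that by (intro mult_right_mono) auto
    finally show ?thesis using l that by (simp add: abs_mult mult.assoc)
  qed
  have 1: "bet_exp (- ?e) l J (Suc n) \<omega> \<ge> bet_exp (- ?e) l J n \<omega> * (1 + l * ?y)"
    using bet_exp_lower[OF J \<omega> _ e, of l] *[of 1] by simp
  have 2: "bet_exp ?e ((1 - t) * l) J (Suc n) \<omega> \<le> bet_exp ?e ((1 - t) * l) J n \<omega> * (1 + (1 - t) * l * ?y)"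
    using bet_exp_upper[OF J \<omega> _ e, of "(1 - t) * l"] *[of "1 - t"] t by simp
  have 3: "bet_exp ?e ((1 + t) * l) J (Suc n) \<omega> \<le> bet_exp ?e ((1 + t) * l) J n \<omega> * (1 + (1 + t) * l * ?y)"
    using bet_exp_upper[OF J \<omega> _ e, of "(1 + t) * l"] *[of "1 + t"] t by simp
  have "tilted t l J n \<omega> + tilted_gain t l J n \<omega> * x n \<omega> =
      bet_exp (- ?e) l J n \<omega> * (1 + l * ?y) - bet_exp ?e ((1 - t) * l) J n \<omega> * (1 + (1 - t) * l * ?y) / 4
       - bet_exp ?e ((1 + t) * l) J n \<omega> * (1 + (1 + t) * l * ?y) / 4"
    by (simp add: tilted_eq tilted_gain_def field_simps)
  thus ?thesis using 1 2 3 unfolding tilted_eq[of _ _ _ "Suc n"] by linarith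
qed

text \<open>The parameter is chosen such that \<open>l\<^sup>2 r ^ (k + 1) = 2 ln k / (1 + 6 t)\<close>: this makes the bound of
  \<open>tilt_le\<close> exactly proportional to \<open>k\<close>, at the border of divergence.\<close>

definition block_tilt :: "real \<Rightarrow> real \<Rightarrow> nat \<Rightarrow> real" where
  "block_tilt t r k = sqrt (2 / (1 + 6 * t) * ln k / r ^ (k + 1))"

definition block :: "real \<Rightarrow> real \<Rightarrow> nat \<Rightarrow> nat \<Rightarrow> 'a \<Rightarrow> bool" where
  "block t r k i \<omega> \<longleftrightarrow> r ^ k \<le> Sq i \<omega> \<and> Sq i \<omega> < r ^ (k + 1) \<and> b i \<omega> \<le> t\<^sup>2 / 8 / block_tilt t r k"

text \<open>The block has been run through up to time \<open>n\<close>, but the sum has not grown by nearly the expected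
  amount. In this situation \<open>tilt\<close> is nonpositive.\<close>

definition miss :: "real \<Rightarrow> real \<Rightarrow> nat \<Rightarrow> nat \<Rightarrow> 'a \<Rightarrow> bool" where
  "miss t r k n \<omega> \<longleftrightarrow>
     2 / (1 + 6 * t) * ln k * (1 - 2 / r) \<le> (block_tilt t r k)\<^sup>2 * bet_square_sum (block t r k) n \<omega> \<and>
     block_tilt t r k * bet_sum (block t r k) n \<omega> \<le> (1 - t) * (2 / (1 + 6 * t) * ln k * (1 - 2 / r)) - ln 4 / t"

lemma bounded_bet_block: "bounded_bet (block t r k) (t\<^sup>2 / 8 / block_tilt t r k)"
proof -
  have [measurable]: "b n \<in> borel_measurable (F n)" "Sq n \<in> borel_measurable (F n)" for n
    using b_measurable Sq_measurable by auto
  have "Measurable.pred (F n) (block t r k n)" for n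
    unfolding block_def[abs_def] by measurable
  thus ?thesis by (auto simp: bounded_bet_def block_def)
qed

lemma bet_square_sum_block_le:
  assumes "\<omega> \<in> space M" "r > 1"
  shows "bet_square_sum (block t r k) n \<omega> \<le> r ^ (k + 1) + (t\<^sup>2 / 8 / block_tilt t r k)\<^sup>2"
proof (induction n)
  case 0
  thus ?case using assms by (simp add: bet_square_sum_def)
next
  case (Suc n)
  show ?case
  proof (cases "block t r k n \<omega>")
    case True
    hence "\<bar>x n \<omega>\<bar> \<le> t\<^sup>2 / 8 / block_tilt t r k"
      using x_bound[OF assms(1), of n] by (simp add: block_def)
    hence "(x n \<omega>)\<^sup>2 \<le> (t\<^sup>2 / 8 / block_tilt t r k)\<^sup>2" by (metis abs_ge_zero power2_abs power_mono)
    moreover have "bet_square_sum (block t r k) n \<omega> \<le> r ^ (k + 1)"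
      using True bet_square_sum_le[of "block t r k" n \<omega>] by (simp add: block_def)
    ultimately show ?thesis using True by (simp add: bet_square_sum_Suc)
  qed (use Suc in \<open>simp add: bet_square_sum_Suc\<close>)
qed

text \<open>The capital \<open>1 - (tilted - 1 / 2) / (C0 * k)\<close> of block \<open>k\<close> starts at \<open>1\<close>, stays nonnegative since
  \<open>tilted \<le> C0 * k\<close>, and is at least \<open>1 + 1 / (2 * C0 * k)\<close> after a miss. The product over the blocks
  is hedged, so Markov's inequality bounds the probability that all blocks are missed.\<close>

lemma miss_prob:
  assumes t: "0 < t" "t \<le> 1" and r: "2 \<le> r" and k0: "2 \<le> k0"
  shows "prob {\<omega>\<in>space M. \<forall>k\<in>{k0..K}. miss t r k n \<omega>}
    \<le> 1 / (\<Prod>k\<in>{k0..K}. 1 + 1 / (2 * exp (1 / 2 + 3 * t + ln 4 / t)) / real k)"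
proof -
  define C0 where "C0 = exp (1 / 2 + 3 * t + ln 4 / t)"
  have C0: "C0 > 0" by (simp add: C0_def)
  define cap where "cap k n \<omega> = 1 - (tilted t (block_tilt t r k) (block t r k) n \<omega> - 1 / 2) / (C0 * real k)" for k n \<omega>
  define gn where "gn k n \<omega> = - 1 / (C0 * real k) * tilted_gain t (block_tilt t r k) (block t r k) n \<omega>" for k n \<omega>
  have lnk: "ln (real k) > 0" if "k \<ge> k0" for k using that k0 by simp
  have block_tilt: "block_tilt t r k > 0" if "k \<ge> k0" for k using lnk[OF that] t r by (simp add: block_tilt_def)
  have lam2: "(block_tilt t r k)\<^sup>2 * r ^ (k + 1) = 2 / (1 + 6 * t) * ln k" if "k \<ge> k0" for k
    using lnk[OF that] t r by (simp add: block_tilt_def)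
  have hi: "tilted t (block_tilt t r k) (block t r k) n \<omega> \<le> C0 * real k" if "k \<ge> k0" "\<omega> \<in> space M" for k n \<omega>
  proof -
    let ?l = "block_tilt t r k" and ?q = "bet_square_sum (block t r k) n \<omega>"
    have "(t\<^sup>2 / 8)\<^sup>2 \<le> 1" using t power_le_one[of t 2] by (intro power_le_one) auto
    have "?l\<^sup>2 * ?q \<le> ?l\<^sup>2 * (r ^ (k + 1) + (t\<^sup>2 / 8 / ?l)\<^sup>2)"
      using bet_square_sum_block_le[OF that(2), of r t k n] r by (intro mult_left_mono) auto
    also have "\<dots> = 2 / (1 + 6 * t) * ln k + (t\<^sup>2 / 8)\<^sup>2"
      unfolding distrib_left lam2[OF that(1)] using block_tilt[OF that(1)] by (simp add: power_divide)
    also have "\<dots> \<le> 2 / (1 + 6 * t) * ln k + 1"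
      using \<open>(t\<^sup>2 / 8)\<^sup>2 \<le> 1\<close> by simp
    finally have q: "?l\<^sup>2 * ?q \<le> 2 / (1 + 6 * t) * ln k + 1" .
    have "?l\<^sup>2 * ?q \<ge> 0" by (auto simp: bet_square_sum_def intro!: sum_nonneg mult_nonneg_nonneg)
    from tilt_le[OF t this q]
    have "tilted t ?l (block t r k) n \<omega> \<le> exp ((2 / (1 + 6 * t) * ln k + 1) * (1 / 2 + 3 * t) + ln 4 / t)"
      by (simp add: tilted_def)
    also have "(2 / (1 + 6 * t) * ln k + 1) * (1 / 2 + 3 * t) + ln 4 / t = ln k + (1 / 2 + 3 * t + ln 4 / t)"
      using t by (simp add: divide_simps) (simp add: algebra_simps)
    also have "exp \<dots> = C0 * real k" using that k0 by (simp add: exp_add C0_def)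
    finally show ?thesis .
  qed
  have cap_nn: "cap k n \<omega> \<ge> 0" if "k \<ge> k0" "\<omega> \<in> space M" for k n \<omega>
  proof -
    have Ck: "C0 * real k > 0" using C0 that k0 by simp
    have "(tilted t (block_tilt t r k) (block t r k) n \<omega> - 1 / 2) / (C0 * real k) \<le> 1"
      using hi[OF that, of n] Ck by (subst divide_le_eq_1_pos) auto
    thus "cap k n \<omega> \<ge> 0" by (simp add: cap_def)
  qed
  have hedge: "hedged (\<lambda>n \<omega>. \<Prod>k\<in>{k0..K}. cap k n \<omega>)"
  proof (rule hedged_prod[where J = "block t r" and g = gn])
    fix k n \<omega> assume k: "k \<in> {k0..K}"
    show "cap k n \<in> bounded_meas n" unfolding cap_def[abs_def]
      by (intro bounded_meas_diff bounded_meas_divide bounded_meas_const tilted_bounded_meas[OF bounded_bet_block])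
    show "gn k n \<in> bounded_meas n" unfolding gn_def[abs_def]
      by (intro bounded_meas_cmult tilted_gain_bounded_meas[OF bounded_bet_block])
    assume \<omega>: "\<omega> \<in> space M"
    have Ck: "C0 * real k > 0" using C0 k k0 by simp
    show "cap k n \<omega> \<ge> 0" using cap_nn[OF _ \<omega>] k by simp
    have "tilted t (block_tilt t r k) (block t r k) (Suc n) \<omega>
        \<ge> tilted t (block_tilt t r k) (block t r k) n \<omega> + tilted_gain t (block_tilt t r k) (block t r k) n \<omega> * x n \<omega>"
      using block_tilt[of k] k by (intro tilted_step[OF bounded_bet_block \<omega> t]) auto
    thus "cap k (Suc n) \<omega> \<le> cap k n \<omega> + gn k n \<omega> * x n \<omega>"
      using Ck unfolding cap_def gn_def by (simp add: divide_simps)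
    show "gn k n \<omega> = 0" if "\<not> block t r k n \<omega>" using that by (simp add: gn_def tilted_gain_def)
    show "j = k" if "j \<in> {k0..K}" "block t r j n \<omega>" "block t r k n \<omega>" for j
    proof (rule ccontr)
      assume "j \<noteq> k"
      hence "j + 1 \<le> k \<or> k + 1 \<le> j" by auto
      hence "r ^ (j + 1) \<le> r ^ k \<or> r ^ (k + 1) \<le> r ^ j"
        using r by (metis numeral_One numeral_le_one_iff one_le_numeral order_trans power_increasing)
      thus False using that(2,3) by (auto simp: block_def)
    qed
  qed auto
  let ?P = "\<Prod>k\<in>{k0..K}. 1 + 1 / (2 * C0) / real k"
  have P: "?P > 0" using C0 by (intro prod_pos) (auto intro!: add_pos_nonneg)
  have "(\<Prod>k\<in>{k0..K}. cap k n \<omega>) \<ge> ?P" if "\<omega> \<in> space M" "\<forall>k\<in>{k0..K}. miss t r k n \<omega>" for \<omega>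
  proof (rule prod_mono, intro conjI)
    fix k assume k: "k \<in> {k0..K}"
    let ?l = "block_tilt t r k" and ?q = "bet_square_sum (block t r k) n \<omega>" and ?u = "bet_sum (block t r k) n \<omega>"
    from that(2) k have m: "2 / (1 + 6 * t) * ln k * (1 - 2 / r) \<le> ?l\<^sup>2 * ?q"
      "?l * ?u \<le> (1 - t) * (2 / (1 + 6 * t) * ln k * (1 - 2 / r)) - ln 4 / t"
      by (auto simp: miss_def)
    have "(1 - t) * (2 / (1 + 6 * t) * ln k * (1 - 2 / r)) \<le> (1 - t) * (?l\<^sup>2 * ?q)"
      using m(1) t by (intro mult_left_mono) auto
    hence "?l * ?u \<le> (1 - t) * (?l\<^sup>2 * ?q) - ln 4 / t" using m(2) by linarith
    moreover have "?l\<^sup>2 * ?q \<ge> 0" by (auto simp: bet_square_sum_def intro!: sum_nonneg mult_nonneg_nonneg)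
    ultimately have "tilted t ?l (block t r k) n \<omega> \<le> 0"
      unfolding tilted_def using t by (intro tilt_nonpos) auto
    thus "1 + 1 / (2 * C0) / real k \<le> cap k n \<omega>"
      using C0 k k0 unfolding cap_def by (simp add: divide_simps)
  qed (use C0 in auto)
  hence "{\<omega>\<in>space M. \<forall>k\<in>{k0..K}. miss t r k n \<omega>} \<subseteq> {\<omega>\<in>space M. (\<Prod>k\<in>{k0..K}. cap k n \<omega>) \<ge> ?P}"
    by auto
  moreover have "(\<lambda>\<omega>. \<Prod>k\<in>{k0..K}. cap k n \<omega>) \<in> borel_measurable M"
    using hedge bounded_meas_measurable measurable_F_M unfolding hedged_def by blast
  ultimately have "prob {\<omega>\<in>space M. \<forall>k\<in>{k0..K}. miss t r k n \<omega>}
      \<le> prob {\<omega>\<in>space M. (\<Prod>k\<in>{k0..K}. cap k n \<omega>) \<ge> ?P}"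
    by (intro finite_measure_mono) auto
  also have "\<dots> \<le> 1 / ?P"
  proof (rule hedged_prob_le[OF hedge _ _ P])
    show "(\<Prod>k\<in>{k0..K}. cap k 0 \<omega>) = 1" for \<omega>
      by (simp add: cap_def tilted_def bet_sum_def bet_square_sum_def tilt_0)
    show "(\<Prod>k\<in>{k0..K}. cap k n \<omega>) \<ge> 0" if "\<omega> \<in> space M" for \<omega> n
      using cap_nn that by (intro prod_nonneg) auto
  qed
  finally show ?thesis unfolding C0_def .
qed

lemma miss_measurable [measurable]: "Measurable.pred M (miss t r k n)"
proof -
  have [measurable]: "bet_sum (block t r k) n \<in> borel_measurable M" "bet_square_sum (block t r k) n \<in> borel_measurable M"
    using bet_sum_bounded_meas[OF bounded_bet_block] bet_square_sum_bounded_meas[OF bounded_bet_block] bounded_meas_measurable measurable_F_M by blast+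
  show ?thesis unfolding miss_def[abs_def] by measurable
qed

text \<open>The estimate for a fixed time \<open>n\<close> carries over to the event that all blocks up to \<open>K\<close> are
  missed from some time on; then \<open>K\<close> tends to infinity.\<close>

lemma miss_AE:
  assumes t: "0 < t" "t \<le> 1" and r: "2 \<le> r" and k0: "2 \<le> k0"
  shows "AE \<omega> in M. \<not> (\<forall>k\<ge>k0. \<forall>\<^sub>F n in sequentially. miss t r k n \<omega>)"
proof -
  define P where "P K = (\<Prod>k\<in>{k0..K}. 1 + 1 / (2 * exp (1 / 2 + 3 * t + ln 4 / t)) / real k)" for K
  define A where "A K N = {\<omega>\<in>space M. \<forall>n\<ge>N. \<forall>k\<in>{k0..K}. miss t r k n \<omega>}" for K N :: nat
  have A [measurable]: "A K N \<in> sets M" for K N unfolding A_def by measurable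
  have AP: "prob (\<Union>N. A K N) \<le> 1 / P K" for K
  proof (rule LIMSEQ_le_const2)
    show "(\<lambda>N. prob (A K N)) \<longlonglongrightarrow> prob (\<Union>N. A K N)"
      by (intro finite_Lim_measure_incseq) (auto simp: A_def incseq_def)
    have "prob (A K N) \<le> 1 / P K" for N
    proof -
      have "prob (A K N) \<le> prob {\<omega>\<in>space M. \<forall>k\<in>{k0..K}. miss t r k N \<omega>}"
        by (intro finite_measure_mono) (auto simp: A_def)
      also have "\<dots> \<le> 1 / P K" unfolding P_def by (rule miss_prob) fact+
      finally show ?thesis .
    qed
    thus "\<exists>N. \<forall>n\<ge>N. prob (A K n) \<le> 1 / P K" by blast
  qed
  define B where "B = (\<Inter>K. \<Union>N. A K N)"
  have B [measurable]: "B \<in> sets M" unfolding B_def by measurable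
  have "prob B \<le> 0"
  proof (rule LIMSEQ_le_const)
    show "(\<lambda>K. 1 / P K) \<longlonglongrightarrow> 0"
      unfolding P_def
      by (intro tendsto_divide_0[OF tendsto_const] filterlim_at_top_imp_at_infinity harmonic_prod_at_top) auto
    have "prob B \<le> 1 / P K" for K
    proof -
      have "prob B \<le> prob (\<Union>N. A K N)" by (rule finite_measure_mono) (auto simp: B_def)
      thus ?thesis using AP[of K] by simp
    qed
    thus "\<exists>N. \<forall>n\<ge>N. prob B \<le> 1 / P n" by blast
  qed
  hence "emeasure M B = 0" by (simp add: emeasure_eq_measure measure_le_0_iff)
  moreover have "{\<omega>\<in>space M. \<not> \<not> (\<forall>k\<ge>k0. \<forall>\<^sub>F n in sequentially. miss t r k n \<omega>)} \<subseteq> B"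
  proof
    fix \<omega> assume "\<omega> \<in> {\<omega>\<in>space M. \<not> \<not> (\<forall>k\<ge>k0. \<forall>\<^sub>F n in sequentially. miss t r k n \<omega>)}"
    hence \<omega>: "\<omega> \<in> space M" "\<forall>k\<ge>k0. \<forall>\<^sub>F n in sequentially. miss t r k n \<omega>" by auto
    have "\<forall>\<^sub>F n in sequentially. \<forall>k\<in>{k0..K}. miss t r k n \<omega>" for K
      using \<omega>(2) by (intro eventually_ball_finite) auto
    thus "\<omega> \<in> B" using \<omega>(1) by (auto simp: B_def A_def eventually_sequentially)
  qed
  ultimately show ?thesis using B by (intro AE_I[of _ _ B])
qed

lemma hit_AE:
  assumes t: "0 < t" "t \<le> 1" and r: "2 \<le> r"
  shows "AE \<omega> in M. \<exists>\<^sub>F k in sequentially. \<exists>\<^sub>F n in sequentially. \<not> miss t r k n \<omega>"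
proof -
  have "AE \<omega> in M. \<forall>k0\<ge>2. \<not> (\<forall>k\<ge>k0. \<forall>\<^sub>F n in sequentially. miss t r k n \<omega>)"
    using miss_AE[OF assms] by (auto simp: AE_all_countable)
  thus ?thesis
  proof eventually_elim
    case (elim \<omega>)
    show ?case unfolding frequently_sequentially[of "\<lambda>k. \<exists>\<^sub>F n in sequentially. \<not> miss t r k n \<omega>"]
    proof
      fix N
      from elim[rule_format, of "max 2 N"]
      show "\<exists>k\<ge>N. \<exists>\<^sub>F n in sequentially. \<not> miss t r k n \<omega>"
        by (auto simp: frequently_def)
    qed
  qed
qed

end

section \<open>Cluster sets of slowly varying sequences\<close>

lemma cluster_setI:
  assumes "\<And>e N. e > 0 \<Longrightarrow> \<exists>n\<ge>N. \<bar>z n - y\<bar> < e"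
  shows "y \<in> cluster_set z"
proof -
  have "\<exists>r. \<forall>n. \<bar>z (r n) - y\<bar> < 1 / real (Suc n) \<and> r n < r (Suc n)"
  proof (rule dependent_nat_choice)
    show "\<exists>m. \<bar>z m - y\<bar> < 1 / real (Suc 0)" using assms[of 1 0] by auto
    show "\<exists>m'. \<bar>z m' - y\<bar> < 1 / real (Suc (Suc n)) \<and> m < m'" for m n
      using assms[of "1 / real (Suc (Suc n))" "Suc m"] by (auto simp: Suc_le_eq)
  qed
  then obtain r where r: "\<And>n. \<bar>z (r n) - y\<bar> < 1 / real (Suc n)" "\<And>n. r n < r (Suc n)" by blast
  have "(\<lambda>n. z (r n) - y) \<longlonglongrightarrow> 0"
  proof (rule Lim_null_comparison)
    show "\<forall>\<^sub>F n in sequentially. norm (z (r n) - y) \<le> 1 / real (Suc n)"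
      using r(1) by (auto intro!: always_eventually less_imp_le)
    show "(\<lambda>n. 1 / real (Suc n)) \<longlonglongrightarrow> 0" by real_asymp
  qed
  hence "(z \<circ> r) \<longlonglongrightarrow> y" by (simp add: LIM_zero_iff o_def)
  moreover have "strict_mono r" using r(2) by (simp add: strict_mono_Suc_iff)
  ultimately show ?thesis unfolding cluster_set_def by blast
qed

lemma cluster_set_le:
  assumes "y \<in> cluster_set z" "\<forall>\<^sub>F n in sequentially. z n \<le> c"
  shows "y \<le> c"
proof -
  from assms obtain r where r: "strict_mono r" "(z \<circ> r) \<longlonglongrightarrow> y" by (auto simp: cluster_set_def)
  have "\<forall>\<^sub>F n in sequentially. z (r n) \<le> c"
    by (rule eventually_compose_filterlim[OF assms(2) filterlim_subseq[OF r(1)]])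
  with r(2) show ?thesis by (intro tendsto_upperbound[of "z \<circ> r" y sequentially c]) auto
qed

lemma cluster_set_ge:
  assumes "y \<in> cluster_set z" "\<forall>\<^sub>F n in sequentially. c \<le> z n"
  shows "c \<le> y"
proof -
  from assms obtain r where r: "strict_mono r" "(z \<circ> r) \<longlonglongrightarrow> y" by (auto simp: cluster_set_def)
  have "\<forall>\<^sub>F n in sequentially. c \<le> z (r n)"
    by (rule eventually_compose_filterlim[OF assms(2) filterlim_subseq[OF r(1)]])
  with r(2) show ?thesis by (intro tendsto_lowerbound[of "z \<circ> r" y sequentially c]) auto
qed

text \<open>Discrete intermediate value argument: on the way from a value near \<open>a\<close> to a later value near \<open>c\<close>,
  the first term above \<open>y - e / 2\<close> cannot overshoot \<open>y\<close> by much, as the increments are small.\<close>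

lemma cluster_set_eq_interval:
  fixes z :: "nat \<Rightarrow> real"
  assumes inc: "(\<lambda>n. z (Suc n) - z n) \<longlonglongrightarrow> 0"
    and up: "\<And>e. e > 0 \<Longrightarrow> \<forall>\<^sub>F n in sequentially. z n \<le> c + e"
    and lo: "\<And>e. e > 0 \<Longrightarrow> \<forall>\<^sub>F n in sequentially. a - e \<le> z n"
    and fup: "\<And>e. e > 0 \<Longrightarrow> \<exists>\<^sub>F n in sequentially. c - e \<le> z n"
    and flo: "\<And>e. e > 0 \<Longrightarrow> \<exists>\<^sub>F n in sequentially. z n \<le> a + e"
  shows "cluster_set z = {a..c}"
proof (intro equalityI subsetI)
  fix y assume y: "y \<in> cluster_set z"
  have "y \<le> c" by (rule field_le_epsilon, rule cluster_set_le[OF y up])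
  moreover have "a \<le> y"
  proof (rule field_le_epsilon)
    fix e :: real assume "e > 0"
    from cluster_set_ge[OF y lo[OF this]] show "a \<le> y + e" by simp
  qed
  ultimately show "y \<in> {a..c}" by simp
next
  fix y assume y: "y \<in> {a..c}"
  show "y \<in> cluster_set z"
  proof (rule cluster_setI)
    fix e :: real and N assume e: "e > 0"
    obtain N1 where N1: "\<And>n. n \<ge> N1 \<Longrightarrow> \<bar>z (Suc n) - z n\<bar> < e / 2"
      using LIMSEQ_D[OF inc, of "e / 2"] e by auto
    obtain n1 where n1: "n1 \<ge> max N N1" "z n1 \<le> a + e / 2"
      using flo[OF half_gt_zero[OF e]] unfolding frequently_sequentially by blast
    obtain n2 where n2: "n2 \<ge> n1" "c - e / 2 \<le> z n2"
      using fup[OF half_gt_zero[OF e]] unfolding frequently_sequentially by blast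
    define m where "m = (LEAST n. n1 \<le> n \<and> y - e / 2 \<le> z n)"
    have "n1 \<le> n2 \<and> y - e / 2 \<le> z n2" using n2 y by auto
    hence m: "n1 \<le> m" "y - e / 2 \<le> z m"
      unfolding m_def by (rule LeastI2, simp)+
    have "z m < y + e"
    proof (cases "m = n1")
      case True
      thus ?thesis using n1 y e by auto
    next
      case False
      then obtain p where p: "m = Suc p" "n1 \<le> p" using m(1) by (cases m) auto
      have "\<not> y - e / 2 \<le> z p"
        using not_less_Least[of p "\<lambda>n. n1 \<le> n \<and> y - e / 2 \<le> z n"] p unfolding m_def[symmetric] by auto
      moreover have "\<bar>z (Suc p) - z p\<bar> < e / 2" using N1[of p] p n1 by auto
      ultimately show ?thesis unfolding p(1) by linarith
    qed
    thus "\<exists>n\<ge>N. \<bar>z n - y\<bar> < e" using m n1 e by (intro exI[of _ m]) auto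
  qed
qed

section \<open>The law of the iterated logarithm\<close>

lemma growing_squares_uminus: "growing_squares xs bs q \<Longrightarrow> growing_squares (\<lambda>i. - xs i) bs q"
  unfolding growing_squares_def power2_minus abs_minus .

context bounded_fair_game
begin

lemma bounded_fair_game_uminus: "bounded_fair_game M F (\<lambda>n \<omega>. - x n \<omega>) b"
proof unfold_locales
  fix n g B assume "g \<in> borel_measurable (F n)" "\<And>\<omega>. \<omega> \<in> space M \<Longrightarrow> \<bar>g \<omega>\<bar> \<le> (B::real)"
  thus "(\<integral>\<omega>. g \<omega> * - x n \<omega> \<partial>M) = 0" using fair[of g n B] by simp
qed (use sub filt x_measurable b_measurable x_bound x_integrable in auto)

text \<open>For the margin \<open>h = 1 / j\<close>, the choice \<open>e = h / 3\<close> and \<open>r = 1 + h / 3\<close> satisfies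
  \<open>(1 + e) r \<le> 1 + h\<close>.\<close>

lemma S_upper:
  assumes gs: "AE \<omega> in M. growing_squares (\<lambda>i. x i \<omega>) (\<lambda>i. b i \<omega>) (\<lambda>n. Sq n \<omega>)"
  shows "AE \<omega> in M. \<forall>j\<ge>1. \<forall>\<^sub>F n in sequentially. S n \<omega> \<le> (1 + 1 / real j)\<^sup>2 * sqrt 2 * lil_norm (Sq n \<omega>)"
proof -
  have "AE \<omega> in M. \<forall>\<^sub>F n in sequentially. S n \<omega> \<le> (1 + 1 / real j)\<^sup>2 * sqrt 2 * lil_norm (Sq n \<omega>)" if j: "j \<ge> 1" for j :: nat
  proof -
    define h where "h = 1 / real j"
    have h: "0 < h" "h \<le> 1" using j by (auto simp: h_def)
    have "h * h \<le> h" using h mult_left_le[of h h] by simp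
    hence "(1 + h / 3) * (1 + h / 3) \<le> 1 + h" using h by (simp add: field_simps)
    from upper_AE[OF _ _ _ this] h
    have "AE \<omega> in M. \<forall>\<^sub>F k in sequentially. \<forall>n. (1 + h / 3) ^ k \<le> Sq n \<omega> \<longrightarrow> Sq n \<omega> \<le> (1 + h / 3) ^ (k + 1) \<longrightarrow>
      (\<forall>i<n. b i \<omega> \<le> (h / 3) / 2 / sqrt (2 * ln k / (1 + h / 3) ^ k)) \<longrightarrow> S n \<omega> < (1 + h) * sqrt (2 * ln k * Sq n \<omega>)"
      by simp
    with gs show ?thesis
    proof eventually_elim
      case (elim \<omega>)
      interpret growing_squares "\<lambda>i. x i \<omega>" "\<lambda>i. b i \<omega>" "\<lambda>n. Sq n \<omega>" by (rule elim)
      show ?case using upper_path[OF _ _ _ elim(2)] h unfolding h_def[symmetric] by simp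
    qed
  qed
  thus ?thesis by (auto simp: AE_all_countable)
qed

text \<open>The constant of \<open>lower_path\<close> for \<open>t = 1 / j\<close> and \<open>r = j\<^sup>2\<close>. It tends to \<open>sqrt 2\<close>.\<close>

definition lower_const :: "nat \<Rightarrow> real" where
  "lower_const j = sqrt (2 / (1 + 6 * (1 / real j))) * (1 - 1 / real j) * (1 - 2 / (real j)\<^sup>2) - 1 / real j - 4 / sqrt ((real j)\<^sup>2)"

lemma S_lower:
  assumes gs: "AE \<omega> in M. growing_squares (\<lambda>i. x i \<omega>) (\<lambda>i. b i \<omega>) (\<lambda>n. Sq n \<omega>)"
    and low: "AE \<omega> in M. \<forall>\<^sub>F n in sequentially. - 2 * lil_norm (Sq n \<omega>) \<le> S n \<omega>"
  shows "AE \<omega> in M. \<forall>j\<ge>2. 0 \<le> lower_const j \<longrightarrow>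
     (\<exists>\<^sub>F n in sequentially. lower_const j / (1 + 1 / real j) * lil_norm (Sq n \<omega>) \<le> S n \<omega>)"
proof -
  have "AE \<omega> in M. \<exists>\<^sub>F n in sequentially. lower_const j / (1 + 1 / real j) * lil_norm (Sq n \<omega>) \<le> S n \<omega>"
    if j: "j \<ge> 2" "0 \<le> lower_const j" for j :: nat
  proof -
    have j4: "2 \<le> (real j)\<^sup>2" using power_mono[of 2 "real j" 2] j by simp
    have t: "0 < 1 / real j" "1 / real j \<le> 1" using j by auto
    show ?thesis using gs low hit_AE[OF t j4]
    proof eventually_elim
      case (elim \<omega>)
      interpret growing_squares "\<lambda>i. x i \<omega>" "\<lambda>i. b i \<omega>" "\<lambda>n. Sq n \<omega>" by (rule elim)
      show ?case unfolding lower_const_def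
        by (rule lower_path[OF t j4 j(2)[unfolded lower_const_def] _ elim(2)])
          (use elim(3) in \<open>simp_all add: S_def miss_def block_tilt_def block_def[abs_def] bet_sum_def bet_square_sum_def\<close>)
    qed
  qed
  thus ?thesis by (auto simp: AE_all_countable)
qed

text \<open>The case \<open>j = 6\<close> of the upper bound, \<open>(7 / 6)\<^sup>2 sqrt 2 < 2\<close>, gives the crude two-sided bound
  that the lower half and the increments rely on.\<close>

theorem cluster_set_AE:
  assumes gs: "AE \<omega> in M. growing_squares (\<lambda>i. x i \<omega>) (\<lambda>i. b i \<omega>) (\<lambda>n. Sq n \<omega>)"
  shows "AE \<omega> in M. cluster_set (\<lambda>n. S n \<omega> / lil_norm (Sq n \<omega>)) = {- sqrt 2 .. sqrt 2}"
proof -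
  interpret neg: bounded_fair_game M F "\<lambda>n \<omega>. - x n \<omega>" b by (rule bounded_fair_game_uminus)
  have negS: "neg.S = (\<lambda>n \<omega>. - S n \<omega>)" and negSq: "neg.Sq = Sq"
    by (simp_all add: fun_eq_iff neg.S_def S_def neg.Sq_def Sq_def sum_negf)
  have gs': "AE \<omega> in M. growing_squares (\<lambda>i. - x i \<omega>) (\<lambda>i. b i \<omega>) (\<lambda>n. neg.Sq n \<omega>)"
    using gs by eventually_elim (simp add: negSq growing_squares_uminus)
  have half: "(1 + 1 / real 6)\<^sup>2 * sqrt 2 \<le> 2"
  proof -
    have "sqrt 2 \<le> 72 / 49" by (rule real_le_lsqrt) (simp_all add: power2_eq_square)
    thus ?thesis by (simp add: power2_eq_square)
  qed
  have two: "s \<le> 2 * lil_norm q" if "s \<le> (1 + 1 / real 6)\<^sup>2 * sqrt 2 * lil_norm q" "q \<ge> 1000" for s q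
    using that(1) mult_right_mono[OF half, of "lil_norm q"] lil_norm_pos[OF that(2)] by linarith
  note up = S_upper[OF gs] and dn = neg.S_upper[OF gs', unfolded negS negSq]
  have bd: "AE \<omega> in M. \<forall>\<^sub>F n in sequentially. \<bar>S n \<omega>\<bar> \<le> 2 * lil_norm (Sq n \<omega>)"
    using gs up dn
  proof eventually_elim
    case (elim \<omega>)
    interpret growing_squares "\<lambda>i. x i \<omega>" "\<lambda>i. b i \<omega>" "\<lambda>n. Sq n \<omega>" by (rule elim)
    have six: "1 \<le> (6::nat)" by simp
    show ?case using elim(2)[rule_format, OF six] elim(3)[rule_format, OF six] q_large[of 1000]
    proof eventually_elim
      case (elim n)
      show ?case using two[OF elim(1,3)] two[OF elim(2,3)] by (simp add: abs_le_iff)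
    qed
  qed
  have "AE \<omega> in M. \<forall>\<^sub>F n in sequentially. - 2 * lil_norm (Sq n \<omega>) \<le> S n \<omega>"
    "AE \<omega> in M. \<forall>\<^sub>F n in sequentially. - 2 * lil_norm (neg.Sq n \<omega>) \<le> neg.S n \<omega>"
    using bd unfolding negS negSq by (eventually_elim, auto elim!: eventually_mono)+
  from S_lower[OF gs this(1)] neg.S_lower[OF gs' this(2)] gs up dn bd
  show ?thesis unfolding negS negSq
  proof eventually_elim
    case (elim \<omega>)
    interpret growing_squares "\<lambda>i. x i \<omega>" "\<lambda>i. b i \<omega>" "\<lambda>n. Sq n \<omega>" by (rule elim)
    note big = q_large[of 1000]
    have upper: "\<exists>j\<ge>1. (1 + 1 / real j)\<^sup>2 * sqrt 2 \<le> sqrt 2 + e" if "e > 0" for e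
    proof -
      have "(\<lambda>j. (1 + 1 / real j)\<^sup>2 * sqrt 2) \<longlonglongrightarrow> sqrt 2" unfolding sqrt_def by real_asymp
      hence "\<forall>\<^sub>F j in sequentially. (1 + 1 / real j)\<^sup>2 * sqrt 2 < sqrt 2 + e"
        using that by (intro order_tendstoD(2)) auto
      from eventually_conj[OF this eventually_ge_at_top[of "1::nat"]] show ?thesis
        by (force dest!: eventually_happens)
    qed
    have lower: "\<exists>j\<ge>2. 0 \<le> lower_const j \<and> sqrt 2 - e \<le> lower_const j / (1 + 1 / real j)" if "e > 0" for e
    proof -
      have lim0: "(\<lambda>j. 1 / real j) \<longlonglongrightarrow> 0" "(\<lambda>j. 2 / (real j)\<^sup>2) \<longlonglongrightarrow> 0" "(\<lambda>j. 4 / sqrt ((real j)\<^sup>2)) \<longlonglongrightarrow> 0"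
        by real_asymp+
      have lim: "(\<lambda>j. lower_const j) \<longlonglongrightarrow> sqrt 2"
        unfolding lower_const_def by (rule tendsto_eq_intros lim0 refl | simp)+
      hence 1: "\<forall>\<^sub>F j in sequentially. 0 < lower_const j"
        by (intro order_tendstoD(1)) auto
      have "(\<lambda>j. lower_const j / (1 + 1 / real j)) \<longlonglongrightarrow> sqrt 2"
        by (rule tendsto_eq_intros lim lim0 refl | simp)+
      hence "\<forall>\<^sub>F j in sequentially. sqrt 2 - e < lower_const j / (1 + 1 / real j)"
        using that by (intro order_tendstoD(1)) auto
      from eventually_conj[OF this eventually_conj[OF 1 eventually_ge_at_top[of "2::nat"]]] show ?thesis
        by (force dest!: eventually_happens)
    qed
    show ?case
    proof (rule cluster_set_eq_interval)
      show "(\<lambda>n. S (Suc n) \<omega> / lil_norm (Sq (Suc n) \<omega>) - S n \<omega> / lil_norm (Sq n \<omega>)) \<longlonglongrightarrow> 0"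
        by (rule increments) (use elim in \<open>auto simp: S_def\<close>)
      fix e :: real assume e: "e > 0"
      from upper[OF e] obtain j where j: "j \<ge> 1" "(1 + 1 / real j)\<^sup>2 * sqrt 2 \<le> sqrt 2 + e" by blast
      show "\<forall>\<^sub>F n in sequentially. S n \<omega> / lil_norm (Sq n \<omega>) \<le> sqrt 2 + e"
        using elim(4)[rule_format, OF j(1)] big
      proof eventually_elim
        case (elim n)
        have "S n \<omega> \<le> (sqrt 2 + e) * lil_norm (Sq n \<omega>)"
          using elim(1) mult_right_mono[OF j(2), of "lil_norm (Sq n \<omega>)"] lil_norm_pos[OF elim(2)] by linarith
        thus ?case using lil_norm_pos[OF elim(2)] by (simp add: divide_le_eq)
      qed
      show "\<forall>\<^sub>F n in sequentially. - sqrt 2 - e \<le> S n \<omega> / lil_norm (Sq n \<omega>)"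
        using elim(5)[rule_format, OF j(1)] big
      proof eventually_elim
        case (elim n)
        have "- S n \<omega> \<le> (sqrt 2 + e) * lil_norm (Sq n \<omega>)"
          using elim(1) mult_right_mono[OF j(2), of "lil_norm (Sq n \<omega>)"] lil_norm_pos[OF elim(2)] by linarith
        thus ?case using lil_norm_pos[OF elim(2)] by (simp add: le_divide_eq algebra_simps)
      qed
      from lower[OF e] obtain i where i: "i \<ge> 2" "0 \<le> lower_const i" "sqrt 2 - e \<le> lower_const i / (1 + 1 / real i)" by blast
      have gen: "sqrt 2 - e \<le> s / lil_norm q" if "lower_const i / (1 + 1 / real i) * lil_norm q \<le> s" "1000 \<le> q" for s q
        using that(1) mult_right_mono[OF i(3), of "lil_norm q"] lil_norm_pos[OF that(2)] by (subst le_divide_eq) auto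
      show "\<exists>\<^sub>F n in sequentially. sqrt 2 - e \<le> S n \<omega> / lil_norm (Sq n \<omega>)"
        by (rule frequently_elim1[OF frequently_eventually_frequently[OF elim(1)[rule_format, OF i(1,2)] big]])
          (use gen in blast)
      show "\<exists>\<^sub>F n in sequentially. S n \<omega> / lil_norm (Sq n \<omega>) \<le> - sqrt 2 + e"
        by (rule frequently_elim1[OF frequently_eventually_frequently[OF elim(2)[rule_format] big]])
          (use i gen in \<open>force simp: neg.lower_const_def lower_const_def\<close>)+
    qed
  qed
qed

end

theorem corollary6p2:
  fixes M :: "'a measure"
    and F :: "nat \<Rightarrow> 'a measure"
    and X m :: "nat \<Rightarrow> 'a \<Rightarrow> real"
  defines "S \<equiv> partial_sum X"
    and "V \<equiv> root_square_sum X"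
  assumes "prob_space M"
    and "martingale_difference_sequence M F X"
    and "\<And>n. n \<ge> 1 \<Longrightarrow> m n \<in> borel_measurable (F (n - 1))"
    and "\<And>n. n \<ge> 1 \<Longrightarrow> AE \<omega> in M. \<bar>X n \<omega>\<bar> \<le> m n \<omega>"
    and "AE \<omega> in M. filterlim (\<lambda>n. V n \<omega>) at_top sequentially"
    and "AE \<omega> in M. (\<lambda>n. m n \<omega> / (V n \<omega> * ln (ln (V n \<omega>)) powr (- 1 / 2))) \<longlonglongrightarrow> 0"
  shows "AE \<omega> in M. cluster_set
           (\<lambda>n. S n \<omega> / (V n \<omega> * sqrt (ln (ln (max (V n \<omega>) (exp 2)))))) = {- sqrt 2 .. sqrt 2}"
proof -
  interpret prob_space M by fact
  note mds = assms(4)[unfolded martingale_difference_sequence_def]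
  have sub: "subalgebra M (F n)" for n using mds by blast
  have filt: "sets (F n) \<subseteq> sets (F (Suc n))" for n
    using mds filtration.sets_F_mono[of "space M" F n "Suc n"] by auto
  have X: "X (Suc n) \<in> borel_measurable (F (Suc n))" "integrable M (X (Suc n))"
    "AE \<omega> in M. real_cond_exp M (F n) (X (Suc n)) \<omega> = 0" for n
    using mds[THEN conjunct2, THEN conjunct2, rule_format, of "Suc n"] by auto
  \<comment> \<open>Cutting \<open>X\<close> off at \<open>\<bar>m\<bar>\<close> changes it on a null set only and makes the bound hold everywhere.\<close>
  define b where "b n \<omega> = \<bar>m (Suc n) \<omega>\<bar>" for n \<omega>
  define x where "x n \<omega> = max (- b n \<omega>) (min (b n \<omega>) (X (Suc n) \<omega>))" for n \<omega>
  have b: "b n \<in> borel_measurable (F n)" for n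
    using assms(5)[of "Suc n"] by (simp add: b_def[abs_def])
  have b_Suc: "b n \<in> borel_measurable (F (Suc n))" for n
    by (rule measurable_from_subalg[OF _ b]) (use sub filt in \<open>auto simp: subalgebra_def\<close>)
  have x: "x n \<in> borel_measurable (F (Suc n))" for n
    unfolding x_def[abs_def] using X(1) b_Suc by (intro borel_measurable_max borel_measurable_min) auto
  have xX: "AE \<omega> in M. X (Suc n) \<omega> = x n \<omega>" for n
    using assms(6)[of "Suc n", simplified] by eventually_elim (auto simp: x_def b_def)
  have xM: "x n \<in> borel_measurable M" for n using measurable_from_subalg[OF sub x] .
  have "bounded_fair_game M F x b"
  proof unfold_locales
    show "integrable M (x n)" for n
      using integrable_cong_AE_imp[OF X(2) xM] xX by blast
    show "\<bar>x n \<omega>\<bar> \<le> b n \<omega>" for n \<omega> by (auto simp: x_def b_def)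
    fix n g and B :: real assume g: "g \<in> borel_measurable (F n)" "\<And>\<omega>. \<omega> \<in> space M \<Longrightarrow> \<bar>g \<omega>\<bar> \<le> B"
    interpret sigma_finite_subalgebra M "F n"
      by (intro finite_measure_subalgebra_is_sigma_finite finite_measure_subalgebra.intro
          finite_measure_subalgebra_axioms.intro finite_measure_axioms sub)
    have gM: "g \<in> borel_measurable M" using measurable_from_subalg[OF sub g(1)] .
    have int: "integrable M (\<lambda>\<omega>. g \<omega> * X (Suc n) \<omega>)"
    proof (rule Bochner_Integration.integrable_bound[of M "\<lambda>\<omega>. B * X (Suc n) \<omega>"])
      show "integrable M (\<lambda>\<omega>. B * X (Suc n) \<omega>)" using X(2) by simp
      show "(\<lambda>\<omega>. g \<omega> * X (Suc n) \<omega>) \<in> borel_measurable M"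
        using gM X(2) by (auto dest: borel_measurable_integrable)
      show "AE \<omega> in M. norm (g \<omega> * X (Suc n) \<omega>) \<le> norm (B * X (Suc n) \<omega>)"
        using g(2) by (intro AE_I2)
          (auto simp: abs_mult intro!: mult_right_mono intro: order_trans[OF _ abs_ge_self])
    qed
    have "(\<integral>\<omega>. g \<omega> * x n \<omega> \<partial>M) = (\<integral>\<omega>. g \<omega> * X (Suc n) \<omega> \<partial>M)"
      using xX[of n] gM xM X(2) by (intro integral_cong_AE) (auto dest: borel_measurable_integrable)
    also have "\<dots> = (\<integral>\<omega>. g \<omega> * real_cond_exp M (F n) (X (Suc n)) \<omega> \<partial>M)"
      using real_cond_exp_intg(2)[OF int g(1)] X(2) by (auto dest: borel_measurable_integrable)
    also have "\<dots> = (\<integral>\<omega>. 0 \<partial>M)"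
      using X(3)[of n] gM by (intro integral_cong_AE) auto
    finally show "(\<integral>\<omega>. g \<omega> * x n \<omega> \<partial>M) = 0" by simp
  qed (use sub filt x b in auto)
  then interpret game: bounded_fair_game M F x b .
  have xX_all: "AE \<omega> in M. \<forall>n. X (Suc n) \<omega> = x n \<omega>" using xX by (simp add: AE_all_countable)
  have S_eq: "S n \<omega> = game.S n \<omega>" and V_eq: "V n \<omega> = sqrt (game.Sq n \<omega>)" if "\<forall>n. X (Suc n) \<omega> = x n \<omega>" for n \<omega>
    using that by (simp_all add: S_def V_def partial_sum_def root_square_sum_def game.S_def game.Sq_def
        sum.atLeast1_atMost_eq)
  have "AE \<omega> in M. growing_squares (\<lambda>i. x i \<omega>) (\<lambda>i. b i \<omega>) (\<lambda>n. game.Sq n \<omega>)"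
    using xX_all assms(7,8)
  proof eventually_elim
    case (elim \<omega>)
    let ?q = "\<lambda>n. game.Sq n \<omega>"
    have q: "filterlim ?q at_top sequentially"
    proof -
      have "filterlim (\<lambda>n. (V n \<omega>)\<^sup>2) at_top sequentially"
        using elim(2) by (intro filterlim_pow_at_top) auto
      moreover have "(V n \<omega>)\<^sup>2 = ?q n" for n
        by (simp add: V_eq[OF elim(1)] game.Sq_def sum_nonneg)
      ultimately show ?thesis by simp
    qed
    show ?case
    proof
      show "?q n = (\<Sum>i<n. (x i \<omega>)\<^sup>2)" for n by (simp add: game.Sq_def)
      show "\<bar>x i \<omega>\<bar> \<le> b i \<omega>" for i by (auto simp: x_def b_def)
      show "filterlim ?q at_top sequentially" by (rule q)
      have "(\<lambda>n. (m (Suc n) \<omega> / (V (Suc n) \<omega> * ln (ln (V (Suc n) \<omega>)) powr (- 1 / 2)))\<^sup>2) \<longlonglongrightarrow> 0\<^sup>2"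
        by (intro tendsto_power LIMSEQ_Suc elim(3))
      moreover have "\<forall>\<^sub>F n in sequentially. 1000 \<le> ?q (Suc n)"
        using filterlim_compose[OF q filterlim_Suc] unfolding filterlim_at_top by blast
      hence "\<forall>\<^sub>F n in sequentially. (m (Suc n) \<omega> / (V (Suc n) \<omega> * ln (ln (V (Suc n) \<omega>)) powr (- 1 / 2)))\<^sup>2
         = (b n \<omega>)\<^sup>2 * lnln_sqrt (?q (Suc n)) / ?q (Suc n)"
      proof eventually_elim
        case (elim n)
        let ?y = "?q (Suc n)"
        have V: "V (Suc n) \<omega> = sqrt ?y" using V_eq \<open>\<forall>n. X (Suc n) \<omega> = x n \<omega>\<close> by blast
        have L: "lnln_sqrt ?y \<ge> 1" using lnln_sqrt_ge_1[OF elim] .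
        have "lnln_sqrt ?y powr (- 1 / 2) = 1 / sqrt (lnln_sqrt ?y)"
          using L by (simp add: powr_minus_divide powr_half_sqrt[symmetric])
        thus ?case unfolding V lnln_sqrt_def[symmetric] using L elim
          by (simp add: power_divide power_mult_distrib b_def)
      qed
      ultimately show "(\<lambda>n. (b n \<omega>)\<^sup>2 * lnln_sqrt (?q (Suc n)) / ?q (Suc n)) \<longlonglongrightarrow> 0"
        using tendsto_cong by fastforce
    qed
  qed
  from game.cluster_set_AE[OF this] xX_all show ?thesis
    by eventually_elim (simp add: S_eq V_eq lil_norm_def)
qed

end
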